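(* Let $k$ be a field of characteristic $0$, let $R$ be a Poisson superalgebra over $k$, and let $R'=R[x;\alpha,\delta]_p$ be a Poisson-Ore extension of $R$ by an even indeterminate $x$. Let $\phi:U(R')\to U(R)[m_x;\sigma_1,\eta_1][h_x;\sigma_2,\eta_2]$ be the superalgebra homomorphism with $\phi(m_r)=m_r$, $\phi(h_r)=h_r$ for $r\in R$, $\phi(m_x)=m_x$, $\phi(h_x)=h_x$, where the iterated Ore extension is determined by $$\sigma_1(m_r)=m_r,\quad \sigma_1(h_r)=h_r+m_{\alpha(r)},\quad \eta_1(m_r)=0,\quad \eta_1(h_r)=m_{\delta(r)},$$ $$\sigma_2(m_r)=m_r,\quad \sigma_2(h_r)=h_r+m_{\alpha(r)},\quad \sigma_2(m_x)=m_x,$$ $$\eta_2(m_r)=m_{\alpha(r)}m_x+m_{\delta(r)},\quad \eta_2(h_r)=(h_{\alpha(r)}+m_{\alpha^2(r)})m_x+m_{\delta\alpha(r)}+h_{\delta(r)},\quad \eta_2(m_x)=0$$ for $r\in R$. Then $\phi$ is an isomorphism.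
   Context: Super objects are $\mathbb Z_2$-graded over $k$, $|\cdot|$ denotes parity, and formulas are for homogeneous elements. Superalgebras are associative, unital, $\mathbb Z_2$-graded; supercommutative means $ab=(-1)^{|a||b|}ba$. For a superalgebra $B$, $[a,b]_{gr}=ab-(-1)^{|a||b|}ba$ and $B_L=(B,[\cdot,\cdot]_{gr})$. A Lie superalgebra has an even bilinear bracket with $\{x,y\}=-(-1)^{|x||y|}\{y,x\}$ and $\{x,\{y,z\}\}+(-1)^{|x|(|y|+|z|)}\{y,\{z,x\}\}+(-1)^{|z|(|x|+|y|)}\{z,\{x,y\}\}=0$. A Poisson superalgebra is a supercommutative superalgebra with a Lie superalgebra bracket satisfying $\{x,yz\}=(-1)^{|x||y|}y\{x,z\}+\{x,y\}z$. A triple $(B,\alpha,\beta)$ satisfies property P with respect to $R$ if $B$ is a superalgebra, $\alpha:R\to B$ is an even superalgebra homomorphism, $\beta:R\to B_L$ is an even Lie superalgebra homomorphism, $\alpha(\{x,y\})=[\beta(x),\alpha(y)]_{gr}$, and $\beta(xy)=\alpha(x)\beta(y)+(-1)^{|x||y|}\alpha(y)\beta(x)$. The universal enveloping algebra $(U(R),m,h)$ is the universal such triple: for any $(B,\gamma,\delta)$ with property P there is a unique superalgebra homomorphism $\phi:U(R)\to B$ with $\phi m=\gamma$, $\phi h=\delta$. Write $m_x=m(x)$, $h_x=h(x)$; $U(R)$ is generated as an algebra by all $m_r,h_r$. Poisson-Ore extension: $\alpha$ is an even Poisson superderivation of $R$ (an even superderivation, $\alpha(rs)=r\alpha(s)+\alpha(r)s$,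 with $\alpha(\{r,s\})=\{\alpha(r),s\}+\{r,\alpha(s)\}$) and $\delta$ is an even superderivation with $\delta(\{r,s\})=\alpha(r)\delta(s)-\delta(r)\alpha(s)+\{r,\delta(s)\}+\{\delta(r),s\}$ for $r,s\in R$; $R[x;\alpha,\delta]_p$ is the polynomial superalgebra $R[x]$ with $x$ even and the Poisson bracket extending that of $R$ with $\{x,r\}=\alpha(r)x+\delta(r)$. Ore extension: for a ring $T$, a ring endomorphism $\sigma$, and an additive map $\eta:T\to T$ with $\eta(st)=\sigma(s)\eta(t)+\eta(s)t$ (a $\sigma$-derivation), $T[y;\sigma,\eta]$ is the free left $T$-module $T[y]$ with the unique ring structure such that $yt=\sigma(t)y+\eta(t)$. Here $\sigma_1$ is extended to an algebra automorphism of $U(R)$, $\eta_1$ to a $\sigma_1$-derivation of $U(R)$, $\sigma_2$ to an algebra automorphism of $U(R)[m_x;\sigma_1,\eta_1]$, and $\eta_2$ to a $\sigma_2$-derivation $U(R)[m_x;\sigma_1,\eta_1]\to U(R)[m_x;\sigma_1,\eta_1]$, all determined by the listed values on generators (these maps are well defined). The variables $m_x,h_x$ are even. On general elements $z=\sum_i c_ix^i\in R'$ ($c_i\in R$), $\phi(m_z)=\sum_i m_{c_i}m_x^i$ and $\phi(h_z)=\sum_i(i\,m_{c_i}m_x^{i-1}h_x+m_x^ih_{c_i})$. *)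

theory Defs
  imports "HOL-Algebra.UnivPoly" "HOL-Library.Z2"
begin

section \<open>Superalgebras\<close>

text \<open>
  Parities live in the two-element field \<^typ>\<open>bit\<close>, so that \<open>\<bar>ab\<bar> = \<bar>a\<bar> + \<bar>b\<bar>\<close> and
  the exponent in \<open>(-1)^(\<bar>a\<bar>\<bar>b\<bar>)\<close> is literally \<open>p * q\<close>.  The identities for homogeneous
  elements are quantified over parities \<open>p, q\<close> and over \<open>x \<in> grade A p\<close>, \<open>y \<in> grade A q\<close>.
\<close>

record ('k, 'a) superalg = "('k, 'a) module" +
  grade :: "bit \<Rightarrow> 'a set"

record ('k, 'a) poisson_superalg = "('k, 'a) superalg" +
  pbracket :: "'a \<Rightarrow> 'a \<Rightarrow> 'a"

definition ksgn :: "('k, 'l) ring_scheme \<Rightarrow> bit \<Rightarrow> 'k" where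
  "ksgn K p = (if p = 0 then \<one>\<^bsub>K\<^esub> else \<ominus>\<^bsub>K\<^esub> \<one>\<^bsub>K\<^esub>)"

text \<open>The library locale \<^locale>\<open>algebra\<close> is restricted to commutative algebras.\<close>

locale assoc_algebra = module K A + A?: ring A for K (structure) and A (structure) +
  assumes smult_mult_left: "\<lbrakk>c \<in> carrier K; x \<in> carrier A; y \<in> carrier A\<rbrakk>
      \<Longrightarrow> (c \<odot>\<^bsub>A\<^esub> x) \<otimes>\<^bsub>A\<^esub> y = c \<odot>\<^bsub>A\<^esub> (x \<otimes>\<^bsub>A\<^esub> y)"
    and smult_mult_right: "\<lbrakk>c \<in> carrier K; x \<in> carrier A; y \<in> carrier A\<rbrakk>
      \<Longrightarrow> x \<otimes>\<^bsub>A\<^esub> (c \<odot>\<^bsub>A\<^esub> y) = c \<odot>\<^bsub>A\<^esub> (x \<otimes>\<^bsub>A\<^esub> y)"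

locale superalgebra = assoc_algebra K A for K (structure) and A (structure) +
  assumes grade_submodule: "submodule (grade A p) K A"
    and grade_sum: "x \<in> carrier A \<Longrightarrow> \<exists>y\<in>grade A 0. \<exists>z\<in>grade A 1. x = y \<oplus>\<^bsub>A\<^esub> z"
    and grade_inter: "grade A 0 \<inter> grade A 1 = {\<zero>\<^bsub>A\<^esub>}"
    and grade_one: "\<one>\<^bsub>A\<^esub> \<in> grade A 0"
    and grade_mult: "\<lbrakk>x \<in> grade A p; y \<in> grade A q\<rbrakk> \<Longrightarrow> x \<otimes>\<^bsub>A\<^esub> y \<in> grade A (p + q)"

locale poisson_superalgebra = superalgebra K R for K (structure) and R (structure) +
  assumes supercommutative: "\<lbrakk>x \<in> grade R p; y \<in> grade R q\<rbrakk>
      \<Longrightarrow> x \<otimes>\<^bsub>R\<^esub> y = ksgn K (p * q) \<odot>\<^bsub>R\<^esub> (y \<otimes>\<^bsub>R\<^esub> x)"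
    and bracket_closed: "\<lbrakk>x \<in> carrier R; y \<in> carrier R\<rbrakk> \<Longrightarrow> pbracket R x y \<in> carrier R"
    and bracket_add_left: "\<lbrakk>x \<in> carrier R; y \<in> carrier R; z \<in> carrier R\<rbrakk>
      \<Longrightarrow> pbracket R (x \<oplus>\<^bsub>R\<^esub> y) z = pbracket R x z \<oplus>\<^bsub>R\<^esub> pbracket R y z"
    and bracket_add_right: "\<lbrakk>x \<in> carrier R; y \<in> carrier R; z \<in> carrier R\<rbrakk>
      \<Longrightarrow> pbracket R x (y \<oplus>\<^bsub>R\<^esub> z) = pbracket R x y \<oplus>\<^bsub>R\<^esub> pbracket R x z"
    and bracket_smult_left: "\<lbrakk>c \<in> carrier K; x \<in> carrier R; y \<in> carrier R\<rbrakk>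
      \<Longrightarrow> pbracket R (c \<odot>\<^bsub>R\<^esub> x) y = c \<odot>\<^bsub>R\<^esub> pbracket R x y"
    and bracket_smult_right: "\<lbrakk>c \<in> carrier K; x \<in> carrier R; y \<in> carrier R\<rbrakk>
      \<Longrightarrow> pbracket R x (c \<odot>\<^bsub>R\<^esub> y) = c \<odot>\<^bsub>R\<^esub> pbracket R x y"
    and bracket_even: "\<lbrakk>x \<in> grade R p; y \<in> grade R q\<rbrakk> \<Longrightarrow> pbracket R x y \<in> grade R (p + q)"
    and bracket_skew: "\<lbrakk>x \<in> grade R p; y \<in> grade R q\<rbrakk>
      \<Longrightarrow> pbracket R x y = \<ominus>\<^bsub>R\<^esub> (ksgn K (p * q) \<odot>\<^bsub>R\<^esub> pbracket R y x)"
    and bracket_jacobi: "\<lbrakk>x \<in> grade R p; y \<in> grade R q; z \<in> grade R r\<rbrakk>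
      \<Longrightarrow> pbracket R x (pbracket R y z)
          \<oplus>\<^bsub>R\<^esub> ksgn K (p * (q + r)) \<odot>\<^bsub>R\<^esub> pbracket R y (pbracket R z x)
          \<oplus>\<^bsub>R\<^esub> ksgn K (r * (p + q)) \<odot>\<^bsub>R\<^esub> pbracket R z (pbracket R x y) = \<zero>\<^bsub>R\<^esub>"
    and bracket_leibniz: "\<lbrakk>x \<in> grade R p; y \<in> grade R q; z \<in> carrier R\<rbrakk>
      \<Longrightarrow> pbracket R x (y \<otimes>\<^bsub>R\<^esub> z)
        = ksgn K (p * q) \<odot>\<^bsub>R\<^esub> (y \<otimes>\<^bsub>R\<^esub> pbracket R x z) \<oplus>\<^bsub>R\<^esub> pbracket R x y \<otimes>\<^bsub>R\<^esub> z"

definition linear_maps ::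
  "('k, 'l) ring_scheme \<Rightarrow> ('k, 'a, 'm) module_scheme \<Rightarrow> ('k, 'b, 'n) module_scheme \<Rightarrow> ('a \<Rightarrow> 'b) set" where
  "linear_maps K A B = {f \<in> carrier A \<rightarrow> carrier B.
     (\<forall>x\<in>carrier A. \<forall>y\<in>carrier A. f (x \<oplus>\<^bsub>A\<^esub> y) = f x \<oplus>\<^bsub>B\<^esub> f y) \<and>
     (\<forall>c\<in>carrier K. \<forall>x\<in>carrier A. f (c \<odot>\<^bsub>A\<^esub> x) = c \<odot>\<^bsub>B\<^esub> f x)}"

definition even_maps ::
  "('k, 'a, 'm) superalg_scheme \<Rightarrow> ('k, 'b, 'n) superalg_scheme \<Rightarrow> ('a \<Rightarrow> 'b) set" where
  "even_maps A B = {f. \<forall>p. f ` grade A p \<subseteq> grade B p}"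

definition algebra_hom ::
  "('k, 'l) ring_scheme \<Rightarrow> ('k, 'a, 'm) module_scheme \<Rightarrow> ('k, 'b, 'n) module_scheme \<Rightarrow> ('a \<Rightarrow> 'b) set" where
  "algebra_hom K A B = ring_hom A B \<inter> linear_maps K A B"

definition algebra_auto ::
  "('k, 'l) ring_scheme \<Rightarrow> ('k, 'a, 'm) module_scheme \<Rightarrow> ('a \<Rightarrow> 'a) set" where
  "algebra_auto K A = {f \<in> algebra_hom K A A. bij_betw f (carrier A) (carrier A)}"

definition superalgebra_hom ::
  "('k, 'l) ring_scheme \<Rightarrow> ('k, 'a, 'm) superalg_scheme \<Rightarrow> ('k, 'b, 'n) superalg_scheme \<Rightarrow> ('a \<Rightarrow> 'b) set" where
  "superalgebra_hom K A B = algebra_hom K A B \<inter> even_maps A B"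

definition superalgebra_iso ::
  "('k, 'l) ring_scheme \<Rightarrow> ('k, 'a, 'm) superalg_scheme \<Rightarrow> ('k, 'b, 'n) superalg_scheme \<Rightarrow> ('a \<Rightarrow> 'b) set" where
  "superalgebra_iso K A B = {f \<in> superalgebra_hom K A B. bij_betw f (carrier A) (carrier B)}"


section \<open>The universal enveloping algebra of a Poisson superalgebra\<close>

text \<open>The graded commutator of \<open>x\<close>, \<open>y\<close>, homogeneous of parities \<open>p\<close>, \<open>q\<close>.\<close>

definition gr_commutator ::
  "('k, 'l) ring_scheme \<Rightarrow> ('k, 'b, 'n) superalg_scheme \<Rightarrow> bit \<Rightarrow> bit \<Rightarrow> 'b \<Rightarrow> 'b \<Rightarrow> 'b" where
  "gr_commutator K B p q x y = (x \<otimes>\<^bsub>B\<^esub> y) \<ominus>\<^bsub>B\<^esub> (ksgn K (p * q) \<odot>\<^bsub>B\<^esub> (y \<otimes>\<^bsub>B\<^esub> x))"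

definition property_P ::
  "('k, 'l) ring_scheme \<Rightarrow> ('k, 'a, 'm) poisson_superalg_scheme \<Rightarrow>
   ('k, 'b, 'n) superalg_scheme \<Rightarrow> ('a \<Rightarrow> 'b) \<Rightarrow> ('a \<Rightarrow> 'b) \<Rightarrow> bool" where
  "property_P K R B \<alpha> \<beta> \<longleftrightarrow>
     superalgebra K B \<and>
     \<alpha> \<in> superalgebra_hom K R B \<and>
     \<beta> \<in> linear_maps K R B \<inter> even_maps R B \<and>
     (\<forall>p q. \<forall>x\<in>grade R p. \<forall>y\<in>grade R q.
        \<beta> (pbracket R x y) = gr_commutator K B p q (\<beta> x) (\<beta> y) \<and>
        \<alpha> (pbracket R x y) = gr_commutator K B p q (\<beta> x) (\<alpha> y) \<and>
        \<beta> (x \<otimes>\<^bsub>R\<^esub> y) = \<alpha> x \<otimes>\<^bsub>B\<^esub> \<beta> y \<oplus>\<^bsub>B\<^esub> ksgn K (p * q) \<odot>\<^bsub>B\<^esub> (\<alpha> y \<otimes>\<^bsub>B\<^esub> \<beta> x))"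

text \<open>
  A property quantified over superalgebras \<open>B\<close> of all types is not expressible as a HOL
  predicate, so \<open>U(R)\<close> is constructed: formal expressions in symbols \<open>m_r\<close>, \<open>h_r\<close> modulo the
  congruence generated by the axioms of associative unital \<open>K\<close>-algebras and by property P.
  That the result has the universal property, with \<open>B\<close> of arbitrary type, is theorem
  \<open>UEA_universal\<close> below.
\<close>

datatype (uea_scalars: 'k, uea_gens: 'a) uea_term =
    Mgen 'a | Hgen 'a | Zero | One
  | Plus "('k, 'a) uea_term" "('k, 'a) uea_term"
  | Times "('k, 'a) uea_term" "('k, 'a) uea_term"
  | Scal 'k "('k, 'a) uea_term"

definition uea_terms ::
  "('k, 'l) ring_scheme \<Rightarrow> ('k, 'a, 'm) poisson_superalg_scheme \<Rightarrow> ('k, 'a) uea_term set" where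
  "uea_terms K R = {t. uea_scalars t \<subseteq> carrier K \<and> uea_gens t \<subseteq> carrier R}"

inductive uea_eq ::
  "('k, 'l) ring_scheme \<Rightarrow> ('k, 'a, 'm) poisson_superalg_scheme \<Rightarrow>
   ('k, 'a) uea_term \<Rightarrow> ('k, 'a) uea_term \<Rightarrow> bool"
  for K :: "('k, 'l) ring_scheme" and R :: "('k, 'a, 'm) poisson_superalg_scheme" where
  refl: "s \<in> uea_terms K R \<Longrightarrow> uea_eq K R s s"
| sym: "uea_eq K R s t \<Longrightarrow> uea_eq K R t s"
| trans: "uea_eq K R s t \<Longrightarrow> uea_eq K R t u \<Longrightarrow> uea_eq K R s u"
| cong_Plus: "uea_eq K R s s' \<Longrightarrow> uea_eq K R t t' \<Longrightarrow> uea_eq K R (Plus s t) (Plus s' t')"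
| cong_Times: "uea_eq K R s s' \<Longrightarrow> uea_eq K R t t' \<Longrightarrow> uea_eq K R (Times s t) (Times s' t')"
| cong_Scal: "c \<in> carrier K \<Longrightarrow> uea_eq K R s s' \<Longrightarrow> uea_eq K R (Scal c s) (Scal c s')"
| plus_assoc: "\<lbrakk>s \<in> uea_terms K R; t \<in> uea_terms K R; u \<in> uea_terms K R\<rbrakk>
    \<Longrightarrow> uea_eq K R (Plus (Plus s t) u) (Plus s (Plus t u))"
| plus_comm: "\<lbrakk>s \<in> uea_terms K R; t \<in> uea_terms K R\<rbrakk> \<Longrightarrow> uea_eq K R (Plus s t) (Plus t s)"
| plus_zero: "s \<in> uea_terms K R \<Longrightarrow> uea_eq K R (Plus Zero s) s"
| plus_neg: "s \<in> uea_terms K R \<Longrightarrow> uea_eq K R (Plus (Scal (\<ominus>\<^bsub>K\<^esub> \<one>\<^bsub>K\<^esub>) s) s) Zero"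
| scal_add: "\<lbrakk>c \<in> carrier K; d \<in> carrier K; s \<in> uea_terms K R\<rbrakk>
    \<Longrightarrow> uea_eq K R (Scal (c \<oplus>\<^bsub>K\<^esub> d) s) (Plus (Scal c s) (Scal d s))"
| scal_plus: "\<lbrakk>c \<in> carrier K; s \<in> uea_terms K R; t \<in> uea_terms K R\<rbrakk>
    \<Longrightarrow> uea_eq K R (Scal c (Plus s t)) (Plus (Scal c s) (Scal c t))"
| scal_mult: "\<lbrakk>c \<in> carrier K; d \<in> carrier K; s \<in> uea_terms K R\<rbrakk>
    \<Longrightarrow> uea_eq K R (Scal (c \<otimes>\<^bsub>K\<^esub> d) s) (Scal c (Scal d s))"
| scal_one: "s \<in> uea_terms K R \<Longrightarrow> uea_eq K R (Scal \<one>\<^bsub>K\<^esub> s) s"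
| times_assoc: "\<lbrakk>s \<in> uea_terms K R; t \<in> uea_terms K R; u \<in> uea_terms K R\<rbrakk>
    \<Longrightarrow> uea_eq K R (Times (Times s t) u) (Times s (Times t u))"
| one_times: "s \<in> uea_terms K R \<Longrightarrow> uea_eq K R (Times One s) s"
| times_one: "s \<in> uea_terms K R \<Longrightarrow> uea_eq K R (Times s One) s"
| times_plus: "\<lbrakk>s \<in> uea_terms K R; t \<in> uea_terms K R; u \<in> uea_terms K R\<rbrakk>
    \<Longrightarrow> uea_eq K R (Times s (Plus t u)) (Plus (Times s t) (Times s u))"
| plus_times: "\<lbrakk>s \<in> uea_terms K R; t \<in> uea_terms K R; u \<in> uea_terms K R\<rbrakk>
    \<Longrightarrow> uea_eq K R (Times (Plus s t) u) (Plus (Times s u) (Times t u))"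
| scal_times: "\<lbrakk>c \<in> carrier K; s \<in> uea_terms K R; t \<in> uea_terms K R\<rbrakk>
    \<Longrightarrow> uea_eq K R (Times (Scal c s) t) (Scal c (Times s t))"
| times_scal: "\<lbrakk>c \<in> carrier K; s \<in> uea_terms K R; t \<in> uea_terms K R\<rbrakk>
    \<Longrightarrow> uea_eq K R (Times s (Scal c t)) (Scal c (Times s t))"
| m_add: "\<lbrakk>x \<in> carrier R; y \<in> carrier R\<rbrakk>
    \<Longrightarrow> uea_eq K R (Mgen (x \<oplus>\<^bsub>R\<^esub> y)) (Plus (Mgen x) (Mgen y))"
| m_smult: "\<lbrakk>c \<in> carrier K; x \<in> carrier R\<rbrakk> \<Longrightarrow> uea_eq K R (Mgen (c \<odot>\<^bsub>R\<^esub> x)) (Scal c (Mgen x))"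
| m_mult: "\<lbrakk>x \<in> carrier R; y \<in> carrier R\<rbrakk>
    \<Longrightarrow> uea_eq K R (Mgen (x \<otimes>\<^bsub>R\<^esub> y)) (Times (Mgen x) (Mgen y))"
| m_one: "uea_eq K R (Mgen \<one>\<^bsub>R\<^esub>) One"
| h_add: "\<lbrakk>x \<in> carrier R; y \<in> carrier R\<rbrakk>
    \<Longrightarrow> uea_eq K R (Hgen (x \<oplus>\<^bsub>R\<^esub> y)) (Plus (Hgen x) (Hgen y))"
| h_smult: "\<lbrakk>c \<in> carrier K; x \<in> carrier R\<rbrakk> \<Longrightarrow> uea_eq K R (Hgen (c \<odot>\<^bsub>R\<^esub> x)) (Scal c (Hgen x))"
| h_bracket: "\<lbrakk>x \<in> grade R p; y \<in> grade R q\<rbrakk>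
    \<Longrightarrow> uea_eq K R (Hgen (pbracket R x y))
          (Plus (Times (Hgen x) (Hgen y)) (Scal (\<ominus>\<^bsub>K\<^esub> ksgn K (p * q)) (Times (Hgen y) (Hgen x))))"
| m_bracket: "\<lbrakk>x \<in> grade R p; y \<in> grade R q\<rbrakk>
    \<Longrightarrow> uea_eq K R (Mgen (pbracket R x y))
          (Plus (Times (Hgen x) (Mgen y)) (Scal (\<ominus>\<^bsub>K\<^esub> ksgn K (p * q)) (Times (Mgen y) (Hgen x))))"
| h_mult: "\<lbrakk>x \<in> grade R p; y \<in> grade R q\<rbrakk>
    \<Longrightarrow> uea_eq K R (Hgen (x \<otimes>\<^bsub>R\<^esub> y))
          (Plus (Times (Mgen x) (Hgen y)) (Scal (ksgn K (p * q)) (Times (Mgen y) (Hgen x))))"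

inductive uea_homog ::
  "('k, 'a, 'm) poisson_superalg_scheme \<Rightarrow> bit \<Rightarrow> ('k, 'a) uea_term \<Rightarrow> bool"
  for R :: "('k, 'a, 'm) poisson_superalg_scheme" where
  "x \<in> grade R p \<Longrightarrow> uea_homog R p (Mgen x)"
| "x \<in> grade R p \<Longrightarrow> uea_homog R p (Hgen x)"
| "uea_homog R p Zero"
| "uea_homog R 0 One"
| "uea_homog R p s \<Longrightarrow> uea_homog R p t \<Longrightarrow> uea_homog R p (Plus s t)"
| "uea_homog R p s \<Longrightarrow> uea_homog R q t \<Longrightarrow> uea_homog R (p + q) (Times s t)"
| "uea_homog R p s \<Longrightarrow> uea_homog R p (Scal c s)"

definition uea_class ::
  "('k, 'l) ring_scheme \<Rightarrow> ('k, 'a, 'm) poisson_superalg_scheme \<Rightarrow>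
   ('k, 'a) uea_term \<Rightarrow> ('k, 'a) uea_term set" where
  "uea_class K R t = {s. uea_eq K R t s}"

abbreviation uea_rep :: "('k, 'a) uea_term set \<Rightarrow> ('k, 'a) uea_term" where
  "uea_rep X \<equiv> (SOME t. t \<in> X)"

definition UEA ::
  "('k, 'l) ring_scheme \<Rightarrow> ('k, 'a, 'm) poisson_superalg_scheme \<Rightarrow>
   ('k, ('k, 'a) uea_term set) superalg" where
  "UEA K R = \<lparr>
     carrier = uea_class K R ` uea_terms K R,
     monoid.mult = (\<lambda>X Y. uea_class K R (Times (uea_rep X) (uea_rep Y))),
     one = uea_class K R One,
     zero = uea_class K R Zero,
     add = (\<lambda>X Y. uea_class K R (Plus (uea_rep X) (uea_rep Y))),
     smult = (\<lambda>c X. uea_class K R (Scal c (uea_rep X))),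
     grade = (\<lambda>p. uea_class K R ` {t \<in> uea_terms K R. uea_homog R p t})\<rparr>"

definition uea_m ::
  "('k, 'l) ring_scheme \<Rightarrow> ('k, 'a, 'm) poisson_superalg_scheme \<Rightarrow> 'a \<Rightarrow> ('k, 'a) uea_term set" where
  "uea_m K R r = uea_class K R (Mgen r)"

definition uea_h ::
  "('k, 'l) ring_scheme \<Rightarrow> ('k, 'a, 'm) poisson_superalg_scheme \<Rightarrow> 'a \<Rightarrow> ('k, 'a) uea_term set" where
  "uea_h K R r = uea_class K R (Hgen r)"


section \<open>Ore extensions\<close>

definition sigma_derivation ::
  "('t, 'm) ring_scheme \<Rightarrow> ('t \<Rightarrow> 't) \<Rightarrow> ('t \<Rightarrow> 't) \<Rightarrow> bool" where
  "sigma_derivation T \<sigma> \<eta> \<longleftrightarrow> \<eta> \<in> carrier T \<rightarrow> carrier T \<and>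
     (\<forall>s\<in>carrier T. \<forall>t\<in>carrier T. \<eta> (s \<oplus>\<^bsub>T\<^esub> t) = \<eta> s \<oplus>\<^bsub>T\<^esub> \<eta> t \<and>
        \<eta> (s \<otimes>\<^bsub>T\<^esub> t) = \<sigma> s \<otimes>\<^bsub>T\<^esub> \<eta> t \<oplus>\<^bsub>T\<^esub> \<eta> s \<otimes>\<^bsub>T\<^esub> t)"

text \<open>
  Left multiplication by the variable: \<open>y (\<Sum> q\<^sub>n y\<^sup>n) = \<Sum> \<sigma>(q\<^sub>n) y\<^sup>n\<^sup>+\<^sup>1 + \<Sum> \<eta>(q\<^sub>n) y\<^sup>n\<close>.
\<close>

definition ore_shift ::
  "('t, 'm) ring_scheme \<Rightarrow> ('t \<Rightarrow> 't) \<Rightarrow> ('t \<Rightarrow> 't) \<Rightarrow> (nat \<Rightarrow> 't) \<Rightarrow> nat \<Rightarrow> 't" where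
  "ore_shift T \<sigma> \<eta> q n = (case n of 0 \<Rightarrow> \<zero>\<^bsub>T\<^esub> | Suc k \<Rightarrow> \<sigma> (q k)) \<oplus>\<^bsub>T\<^esub> \<eta> (q n)"

text \<open>
  The left \<open>T\<close>-module \<open>T[y]\<close> is that of \<^term>\<open>UP T\<close>, and \<open>(\<Sum> p\<^sub>i y\<^sup>i) q = \<Sum> p\<^sub>i (y\<^sup>i q)\<close>.
  The variable \<open>y\<close> is even and the scalars of \<open>K\<close> act coefficientwise.  Theorem
  \<open>ore_ext_ring\<close> below shows that this is a ring in which \<open>y t = \<sigma>(t) y + \<eta>(t)\<close>.
\<close>

definition ore_ext ::
  "('k, 't, 'm) superalg_scheme \<Rightarrow> ('t \<Rightarrow> 't) \<Rightarrow> ('t \<Rightarrow> 't) \<Rightarrow> ('k, nat \<Rightarrow> 't) superalg" where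
  "ore_ext T \<sigma> \<eta> = \<lparr>
     carrier = carrier (UP T),
     monoid.mult = (\<lambda>p q n. \<Oplus>\<^bsub>T\<^esub>i\<in>{i. p i \<noteq> \<zero>\<^bsub>T\<^esub>}. p i \<otimes>\<^bsub>T\<^esub> (ore_shift T \<sigma> \<eta> ^^ i) q n),
     one = one (UP T),
     zero = zero (UP T),
     add = add (UP T),
     smult = (\<lambda>c p n. c \<odot>\<^bsub>T\<^esub> p n),
     grade = (\<lambda>d. {p \<in> carrier (UP T). \<forall>n. p n \<in> grade T d})\<rparr>"

definition const_poly :: "('t, 'm) ring_scheme \<Rightarrow> 't \<Rightarrow> nat \<Rightarrow> 't" where
  "const_poly T t = monom (UP T) t 0"

definition var_poly :: "('t, 'm) ring_scheme \<Rightarrow> nat \<Rightarrow> 't" where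
  "var_poly T = monom (UP T) \<one>\<^bsub>T\<^esub> 1"


section \<open>Poisson-Ore extensions\<close>

definition even_superderivation ::
  "('k, 'l) ring_scheme \<Rightarrow> ('k, 'a, 'm) superalg_scheme \<Rightarrow> ('a \<Rightarrow> 'a) \<Rightarrow> bool" where
  "even_superderivation K R d \<longleftrightarrow> d \<in> linear_maps K R R \<inter> even_maps R R \<and>
     (\<forall>r\<in>carrier R. \<forall>s\<in>carrier R. d (r \<otimes>\<^bsub>R\<^esub> s) = r \<otimes>\<^bsub>R\<^esub> d s \<oplus>\<^bsub>R\<^esub> d r \<otimes>\<^bsub>R\<^esub> s)"

definition even_poisson_superderivation ::
  "('k, 'l) ring_scheme \<Rightarrow> ('k, 'a, 'm) poisson_superalg_scheme \<Rightarrow> ('a \<Rightarrow> 'a) \<Rightarrow> bool" where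
  "even_poisson_superderivation K R \<alpha> \<longleftrightarrow> even_superderivation K R \<alpha> \<and>
     (\<forall>r\<in>carrier R. \<forall>s\<in>carrier R.
        \<alpha> (pbracket R r s) = pbracket R (\<alpha> r) s \<oplus>\<^bsub>R\<^esub> pbracket R r (\<alpha> s))"

definition poly_superalg :: "('k, 'a, 'm) superalg_scheme \<Rightarrow> ('k, nat \<Rightarrow> 'a) superalg" where
  "poly_superalg R = \<lparr>
     carrier = carrier (UP R),
     monoid.mult = monoid.mult (UP R),
     one = one (UP R),
     zero = zero (UP R),
     add = add (UP R),
     smult = (\<lambda>c p n. c \<odot>\<^bsub>R\<^esub> p n),
     grade = (\<lambda>d. {p \<in> carrier (UP R). \<forall>n. p n \<in> grade R d})\<rparr>"

text \<open>
  The bracket of \<open>R' = R[x; \<alpha>, \<delta>]\<^sub>p\<close> is specified by its defining property rather than by a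
  formula: \<open>R'\<close> is the polynomial superalgebra (with \<open>x\<close> even) equipped with some Poisson
  bracket that extends the one of \<open>R\<close> and satisfies \<open>{x, r} = \<alpha>(r) x + \<delta>(r)\<close>.
\<close>

definition poisson_ore_ext ::
  "('k, 'l) ring_scheme \<Rightarrow> ('k, 'a, 'm) poisson_superalg_scheme \<Rightarrow> ('a \<Rightarrow> 'a) \<Rightarrow> ('a \<Rightarrow> 'a) \<Rightarrow>
   ('k, nat \<Rightarrow> 'a) poisson_superalg \<Rightarrow> bool" where
  "poisson_ore_ext K R \<alpha> \<delta> R' \<longleftrightarrow>
     even_poisson_superderivation K R \<alpha> \<and>
     even_superderivation K R \<delta> \<and>
     (\<forall>r\<in>carrier R. \<forall>s\<in>carrier R.
        \<delta> (pbracket R r s) = ((\<alpha> r \<otimes>\<^bsub>R\<^esub> \<delta> s) \<ominus>\<^bsub>R\<^esub> (\<delta> r \<otimes>\<^bsub>R\<^esub> \<alpha> s))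
          \<oplus>\<^bsub>R\<^esub> pbracket R r (\<delta> s) \<oplus>\<^bsub>R\<^esub> pbracket R (\<delta> r) s) \<and>
     superalg.truncate R' = poly_superalg R \<and>
     poisson_superalgebra K R' \<and>
     (\<forall>r\<in>carrier R. \<forall>s\<in>carrier R.
        pbracket R' (const_poly R r) (const_poly R s) = const_poly R (pbracket R r s)) \<and>
     (\<forall>r\<in>carrier R.
        pbracket R' (var_poly R) (const_poly R r)
          = const_poly R (\<alpha> r) \<otimes>\<^bsub>R'\<^esub> var_poly R \<oplus>\<^bsub>R'\<^esub> const_poly R (\<delta> r))"


section \<open>The universal property of \<open>U(R)\<close>\<close>


text \<open>Property P without the grading.\<close>

definition pre_property_P ::
  "('k, 'l) ring_scheme \<Rightarrow> ('k, 'a, 'm) poisson_superalg_scheme \<Rightarrow>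
   ('k, 'b, 'n) superalg_scheme \<Rightarrow> ('a \<Rightarrow> 'b) \<Rightarrow> ('a \<Rightarrow> 'b) \<Rightarrow> bool" where
  "pre_property_P K R B \<alpha> \<beta> \<longleftrightarrow>
     assoc_algebra K B \<and> \<alpha> \<in> algebra_hom K R B \<and> \<beta> \<in> linear_maps K R B \<and>
     (\<forall>p q. \<forall>x\<in>grade R p. \<forall>y\<in>grade R q.
        \<beta> (pbracket R x y) = gr_commutator K B p q (\<beta> x) (\<beta> y) \<and>
        \<alpha> (pbracket R x y) = gr_commutator K B p q (\<beta> x) (\<alpha> y) \<and>
        \<beta> (x \<otimes>\<^bsub>R\<^esub> y) = \<alpha> x \<otimes>\<^bsub>B\<^esub> \<beta> y \<oplus>\<^bsub>B\<^esub> ksgn K (p * q) \<odot>\<^bsub>B\<^esub> (\<alpha> y \<otimes>\<^bsub>B\<^esub> \<beta> x))"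

primrec uea_eval ::
  "('k, 'b, 'n) superalg_scheme \<Rightarrow> ('a \<Rightarrow> 'b) \<Rightarrow> ('a \<Rightarrow> 'b) \<Rightarrow> ('k, 'a) uea_term \<Rightarrow> 'b" where
  "uea_eval B \<gamma> \<delta> (Mgen x) = \<gamma> x"
| "uea_eval B \<gamma> \<delta> (Hgen x) = \<delta> x"
| "uea_eval B \<gamma> \<delta> Zero = \<zero>\<^bsub>B\<^esub>"
| "uea_eval B \<gamma> \<delta> One = \<one>\<^bsub>B\<^esub>"
| "uea_eval B \<gamma> \<delta> (Plus s t) = uea_eval B \<gamma> \<delta> s \<oplus>\<^bsub>B\<^esub> uea_eval B \<gamma> \<delta> t"
| "uea_eval B \<gamma> \<delta> (Times s t) = uea_eval B \<gamma> \<delta> s \<otimes>\<^bsub>B\<^esub> uea_eval B \<gamma> \<delta> t"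
| "uea_eval B \<gamma> \<delta> (Scal c s) = c \<odot>\<^bsub>B\<^esub> uea_eval B \<gamma> \<delta> s"

lemma uea_terms_simps [simp]:
  "Mgen x \<in> uea_terms K R \<longleftrightarrow> x \<in> carrier R"
  "Hgen x \<in> uea_terms K R \<longleftrightarrow> x \<in> carrier R"
  "Zero \<in> uea_terms K R"
  "One \<in> uea_terms K R"
  "Plus s t \<in> uea_terms K R \<longleftrightarrow> s \<in> uea_terms K R \<and> t \<in> uea_terms K R"
  "Times s t \<in> uea_terms K R \<longleftrightarrow> s \<in> uea_terms K R \<and> t \<in> uea_terms K R"
  "Scal c s \<in> uea_terms K R \<longleftrightarrow> c \<in> carrier K \<and> s \<in> uea_terms K R"
  by (auto simp: uea_terms_def)

lemma (in superalgebra) grade_closed: "x \<in> grade A p \<Longrightarrow> x \<in> carrier A"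
  using grade_submodule[of p] by (meson subsetD submoduleE(1))

lemma (in module) ksgn_closed [simp]: "ksgn R p \<in> carrier R"
  by (simp add: ksgn_def)

context poisson_superalgebra
begin

lemma uea_eq_terms: "uea_eq K R s t \<Longrightarrow> s \<in> uea_terms K R \<and> t \<in> uea_terms K R"
  by (induction rule: uea_eq.induct) (auto intro: grade_closed bracket_closed)

lemma uea_class_eq_iff:
  "s \<in> uea_terms K R \<Longrightarrow> uea_class K R s = uea_class K R t \<longleftrightarrow> uea_eq K R s t"
  unfolding uea_class_def by (auto intro: uea_eq.intros(1-3))

lemma uea_class_eqI: "uea_eq K R s t \<Longrightarrow> uea_class K R s = uea_class K R t"
  using uea_class_eq_iff uea_eq_terms by blast

lemma uea_rep_eq:
  assumes "t \<in> uea_terms K R"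
  shows "uea_eq K R t (uea_rep (uea_class K R t))"
proof -
  have "t \<in> uea_class K R t" using assms by (simp add: uea_class_def uea_eq.refl)
  hence "uea_rep (uea_class K R t) \<in> uea_class K R t" by (metis someI)
  thus ?thesis by (simp add: uea_class_def)
qed

lemma uea_class_in [simp]: "t \<in> uea_terms K R \<Longrightarrow> uea_class K R t \<in> uea_class K R ` uea_terms K R"
  by (rule imageI)

lemma UEA_simps:
  "carrier (UEA K R) = uea_class K R ` uea_terms K R"
  "\<one>\<^bsub>UEA K R\<^esub> = uea_class K R One"
  "\<zero>\<^bsub>UEA K R\<^esub> = uea_class K R Zero"
  "grade (UEA K R) p = uea_class K R ` {t \<in> uea_terms K R. uea_homog R p t}"
  "\<lbrakk>s \<in> uea_terms K R; t \<in> uea_terms K R\<rbrakk>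
    \<Longrightarrow> uea_class K R s \<otimes>\<^bsub>UEA K R\<^esub> uea_class K R t = uea_class K R (Times s t)"
  "\<lbrakk>s \<in> uea_terms K R; t \<in> uea_terms K R\<rbrakk>
    \<Longrightarrow> uea_class K R s \<oplus>\<^bsub>UEA K R\<^esub> uea_class K R t = uea_class K R (Plus s t)"
  "\<lbrakk>c \<in> carrier K; t \<in> uea_terms K R\<rbrakk>
    \<Longrightarrow> c \<odot>\<^bsub>UEA K R\<^esub> uea_class K R t = uea_class K R (Scal c t)"
  by (auto simp: UEA_def intro!: uea_class_eqI uea_eq.cong_Times uea_eq.cong_Plus uea_eq.cong_Scal
      uea_rep_eq uea_eq.sym[OF uea_rep_eq] del: equalityI)

lemma UEA_assoc_algebra: "assoc_algebra K (UEA K R)"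
proof -
  have ag: "abelian_group (UEA K R)"
  proof (rule abelian_groupI)
    fix X assume "X \<in> carrier (UEA K R)"
    then obtain s where s: "s \<in> uea_terms K R" "X = uea_class K R s" by (auto simp: UEA_simps)
    show "\<exists>Y\<in>carrier (UEA K R). Y \<oplus>\<^bsub>UEA K R\<^esub> X = \<zero>\<^bsub>UEA K R\<^esub>"
      using s by (intro bexI[of _ "uea_class K R (Scal (\<ominus>\<^bsub>K\<^esub> \<one>\<^bsub>K\<^esub>) s)"])
        (auto simp: UEA_simps uea_class_eq_iff intro!: uea_eq.plus_neg del: equalityI)
  qed (auto simp: UEA_simps uea_class_eq_iff intro: imageI uea_eq.intros del: equalityI)
  moreover have "monoid (UEA K R)"
    by (rule monoidI) (auto simp: UEA_simps uea_class_eq_iff intro: imageI uea_eq.intros del: equalityI)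
  ultimately have ring: "ring (UEA K R)"
    by (intro ring.intro ring_axioms.intro)
      (auto simp: UEA_simps uea_class_eq_iff intro: imageI uea_eq.intros del: equalityI)
  have "module K (UEA K R)"
    by (rule moduleI)
      (auto simp: UEA_simps uea_class_eq_iff ag R.is_cring intro: imageI uea_eq.intros del: equalityI)
  with ring show ?thesis
    by (intro assoc_algebra.intro assoc_algebra_axioms.intro)
      (auto simp: UEA_simps uea_class_eq_iff intro: imageI uea_eq.intros del: equalityI)
qed

lemma ksgn_minus: "assoc_algebra K B \<Longrightarrow> x \<in> carrier B \<Longrightarrow> (\<ominus>\<^bsub>K\<^esub> ksgn K p) \<odot>\<^bsub>B\<^esub> x = \<ominus>\<^bsub>B\<^esub> (ksgn K p \<odot>\<^bsub>B\<^esub> x)"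
  by (simp add: module.smult_l_minus assoc_algebra.axioms(1))

lemma UEA_pre: "pre_property_P K R (UEA K R) (uea_m K R) (uea_h K R)"
proof -
  interpret U: assoc_algebra K "UEA K R" by (rule UEA_assoc_algebra)
  have c: "gr_commutator K (UEA K R) p q (uea_class K R s) (uea_class K R t)
    = uea_class K R (Plus (Times s t) (Scal (\<ominus>\<^bsub>K\<^esub> ksgn K (p * q)) (Times t s)))"
    if "s \<in> uea_terms K R" "t \<in> uea_terms K R" for p q s t
  proof -
    have "\<ominus>\<^bsub>UEA K R\<^esub> (ksgn K (p * q) \<odot>\<^bsub>UEA K R\<^esub> uea_class K R (Times t s))
        = (\<ominus>\<^bsub>K\<^esub> ksgn K (p * q)) \<odot>\<^bsub>UEA K R\<^esub> uea_class K R (Times t s)"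
      using that by (subst ksgn_minus[OF UEA_assoc_algebra]) (auto simp: UEA_simps)
    thus ?thesis using that by (simp add: gr_commutator_def a_minus_def UEA_simps)
  qed
  have rel: "uea_h K R (pbracket R x y) = gr_commutator K (UEA K R) p q (uea_h K R x) (uea_h K R y) \<and>
      uea_m K R (pbracket R x y) = gr_commutator K (UEA K R) p q (uea_h K R x) (uea_m K R y) \<and>
      uea_h K R (x \<otimes>\<^bsub>R\<^esub> y) = uea_m K R x \<otimes>\<^bsub>UEA K R\<^esub> uea_h K R y
        \<oplus>\<^bsub>UEA K R\<^esub> ksgn K (p * q) \<odot>\<^bsub>UEA K R\<^esub> (uea_m K R y \<otimes>\<^bsub>UEA K R\<^esub> uea_h K R x)"
    if "x \<in> grade R p" "y \<in> grade R q" for p q x y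
    using that uea_eq.h_bracket[OF that, of K] uea_eq.m_bracket[OF that, of K] uea_eq.h_mult[OF that, of K]
    by (simp add: uea_m_def uea_h_def c UEA_simps uea_class_eqI grade_closed del: mult_bit_eq_and)
  have m: "uea_m K R \<in> algebra_hom K R (UEA K R)" and h: "uea_h K R \<in> linear_maps K R (UEA K R)"
    unfolding algebra_hom_def linear_maps_def ring_hom_def uea_m_def uea_h_def
    by (auto simp: UEA_simps uea_class_eq_iff intro: imageI uea_eq.intros del: equalityI)
  show ?thesis unfolding pre_property_P_def using UEA_assoc_algebra m h rel by blast
qed

lemma uea_eval_closed:
  assumes "pre_property_P K R B \<gamma> \<delta>" "t \<in> uea_terms K R"
  shows "uea_eval B \<gamma> \<delta> t \<in> carrier B"
proof -
  interpret B: assoc_algebra K B using assms(1) by (simp add: pre_property_P_def)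
  have "\<gamma> \<in> carrier R \<rightarrow> carrier B" "\<delta> \<in> carrier R \<rightarrow> carrier B"
    using assms(1) by (auto simp: pre_property_P_def algebra_hom_def linear_maps_def)
  thus ?thesis using assms(2) by (induction t) auto
qed

lemma uea_eval_cong:
  assumes P: "pre_property_P K R B \<gamma> \<delta>" and "uea_eq K R s t"
  shows "uea_eval B \<gamma> \<delta> s = uea_eval B \<gamma> \<delta> t"
proof -
  interpret B: assoc_algebra K B using P by (simp add: pre_property_P_def)
  note cl = uea_eval_closed[OF P]
  have g: "\<And>x. x \<in> carrier R \<Longrightarrow> \<gamma> x \<in> carrier B" "\<And>x. x \<in> carrier R \<Longrightarrow> \<delta> x \<in> carrier B"
    using P by (auto simp: pre_property_P_def algebra_hom_def linear_maps_def)
  have neg: "(\<ominus>\<^bsub>K\<^esub> ksgn K p) \<odot>\<^bsub>B\<^esub> x = \<ominus>\<^bsub>B\<^esub> (ksgn K p \<odot>\<^bsub>B\<^esub> x)" if "x \<in> carrier B" for p x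
    using that by (simp add: B.smult_l_minus)
  show ?thesis using assms(2)
  proof (induction rule: uea_eq.induct)
    case (plus_neg s)
    have "(\<ominus>\<^bsub>K\<^esub> \<one>\<^bsub>K\<^esub>) \<odot>\<^bsub>B\<^esub> uea_eval B \<gamma> \<delta> s = \<ominus>\<^bsub>B\<^esub> uea_eval B \<gamma> \<delta> s"
      using cl[OF plus_neg] by (simp add: B.smult_l_minus)
    thus ?case using cl[OF plus_neg] by (simp add: B.l_neg)
  next
    case (plus_comm s t)
    thus ?case using cl by (simp add: B.a_comm)
  next
    case (h_bracket x p y q)
    thus ?case using P g grade_closed by (simp add: pre_property_P_def gr_commutator_def a_minus_def neg)
  next
    case (m_bracket x p y q)
    thus ?case using P g grade_closed by (simp add: pre_property_P_def gr_commutator_def a_minus_def neg)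
  qed (use P cl in \<open>auto simp: pre_property_P_def algebra_hom_def linear_maps_def ring_hom_def
         B.a_assoc B.m_assoc B.l_distr B.r_distr B.smult_l_distr B.smult_r_distr B.smult_assoc1
         B.smult_mult_left B.smult_mult_right\<close>)
qed

lemma uea_eval_rep:
  "pre_property_P K R B \<gamma> \<delta> \<Longrightarrow> t \<in> uea_terms K R
    \<Longrightarrow> uea_eval B \<gamma> \<delta> (uea_rep (uea_class K R t)) = uea_eval B \<gamma> \<delta> t"
  using uea_eval_cong uea_rep_eq by metis

lemma uea_eval_UEA:
  "t \<in> uea_terms K R \<Longrightarrow> uea_eval (UEA K R) (uea_m K R) (uea_h K R) t = uea_class K R t"
  by (induction t) (auto simp: UEA_simps uea_m_def uea_h_def)

end

text \<open>\<open>A \<otimes> K[\<int>/2]\<close>, used to show that the homogeneous pieces of \<open>U(R)\<close> are independent.\<close>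

definition double_alg :: "('k, 'b, 'n) superalg_scheme \<Rightarrow> ('k, 'b \<times> 'b) superalg" where
  "double_alg A = \<lparr>
     carrier = carrier A \<times> carrier A,
     monoid.mult = (\<lambda>(a, b) (c, d). (a \<otimes>\<^bsub>A\<^esub> c \<oplus>\<^bsub>A\<^esub> b \<otimes>\<^bsub>A\<^esub> d, a \<otimes>\<^bsub>A\<^esub> d \<oplus>\<^bsub>A\<^esub> b \<otimes>\<^bsub>A\<^esub> c)),
     one = (\<one>\<^bsub>A\<^esub>, \<zero>\<^bsub>A\<^esub>),
     zero = (\<zero>\<^bsub>A\<^esub>, \<zero>\<^bsub>A\<^esub>),
     add = (\<lambda>(a, b) (c, d). (a \<oplus>\<^bsub>A\<^esub> c, b \<oplus>\<^bsub>A\<^esub> d)),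
     smult = (\<lambda>k (a, b). (k \<odot>\<^bsub>A\<^esub> a, k \<odot>\<^bsub>A\<^esub> b)),
     grade = (\<lambda>p. if p = 0 then carrier A \<times> {\<zero>\<^bsub>A\<^esub>} else {\<zero>\<^bsub>A\<^esub>} \<times> carrier A)\<rparr>"

definition in_parity :: "('k, 'b, 'n) superalg_scheme \<Rightarrow> bit \<Rightarrow> 'b \<Rightarrow> 'b \<times> 'b" where
  "in_parity A p a = (if p = 0 then (a, \<zero>\<^bsub>A\<^esub>) else (\<zero>\<^bsub>A\<^esub>, a))"

lemma double_assoc_algebra:
  assumes "assoc_algebra K A"
  shows "assoc_algebra K (double_alg A)"
proof -
  interpret A: assoc_algebra K A by (rule assms)
  have ag: "abelian_group (double_alg A)"
  proof (rule abelian_groupI)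
    fix X assume "X \<in> carrier (double_alg A)"
    then obtain a b where s: "a \<in> carrier A" "b \<in> carrier A" "X = (a, b)" by (auto simp: double_alg_def)
    show "\<exists>Y\<in>carrier (double_alg A). Y \<oplus>\<^bsub>double_alg A\<^esub> X = \<zero>\<^bsub>double_alg A\<^esub>"
      using s by (intro bexI[of _ "(\<ominus>\<^bsub>A\<^esub> a, \<ominus>\<^bsub>A\<^esub> b)"]) (auto simp: double_alg_def A.l_neg)
  qed (auto simp: double_alg_def A.a_ac)
  moreover have "monoid (double_alg A)"
    by (rule monoidI) (auto simp: double_alg_def A.l_distr A.r_distr A.m_assoc A.a_ac)
  ultimately have ring: "ring (double_alg A)"
    by (intro ring.intro ring_axioms.intro) (auto simp: double_alg_def A.l_distr A.r_distr A.a_ac)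
  have "module K (double_alg A)"
    by (rule moduleI[OF _ ag])
      (auto simp: A.R.is_cring double_alg_def A.smult_l_distr A.smult_r_distr A.smult_assoc1)
  with ring show ?thesis
    by (intro assoc_algebra.intro assoc_algebra_axioms.intro)
      (auto simp: double_alg_def A.smult_mult_left A.smult_mult_right A.smult_r_distr)
qed


lemma double_pre:
  fixes R :: "('k, 'a, 'm) poisson_superalg_scheme"
  assumes R: "poisson_superalgebra K R"
  defines "D \<equiv> double_alg (UEA K R)"
  shows "\<exists>M H. pre_property_P K R D M H
    \<and> (\<forall>p. \<forall>x\<in>grade R p. M x = in_parity (UEA K R) p (uea_m K R x) \<and> H x = in_parity (UEA K R) p (uea_h K R x))"
proof -
  interpret R: poisson_superalgebra K R by (rule R)
  let ?U = "UEA K R"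
  interpret U: assoc_algebra K ?U by (rule R.UEA_assoc_algebra)
  interpret D: assoc_algebra K D unfolding D_def by (rule double_assoc_algebra[OF R.UEA_assoc_algebra])
  have pre: "pre_property_P K R ?U (uea_m K R) (uea_h K R)" by (rule R.UEA_pre)
  define e where "e x = (SOME y. y \<in> grade R 0 \<and> (\<exists>z\<in>grade R 1. x = y \<oplus>\<^bsub>R\<^esub> z))" for x
  define o' where "o' x = (SOME z. z \<in> grade R 1 \<and> x = e x \<oplus>\<^bsub>R\<^esub> z)" for x
  have eo: "e x \<in> grade R 0" "o' x \<in> grade R 1" "x = e x \<oplus>\<^bsub>R\<^esub> o' x" if "x \<in> carrier R" for x
  proof -
    have "e x \<in> grade R 0 \<and> (\<exists>z\<in>grade R 1. x = e x \<oplus>\<^bsub>R\<^esub> z)"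
      unfolding e_def by (rule someI_ex) (use R.grade_sum[OF that] in blast)
    hence *: "e x \<in> grade R 0" "\<exists>z. z \<in> grade R 1 \<and> x = e x \<oplus>\<^bsub>R\<^esub> z" by blast+
    have "o' x \<in> grade R 1 \<and> x = e x \<oplus>\<^bsub>R\<^esub> o' x" unfolding o'_def using *(2) by (rule someI_ex)
    with * show "e x \<in> grade R 0" "o' x \<in> grade R 1" "x = e x \<oplus>\<^bsub>R\<^esub> o' x" by blast+
  qed
  have uniq: "e x = y \<and> o' x = z" if "y \<in> grade R 0" "z \<in> grade R 1" "x = y \<oplus>\<^bsub>R\<^esub> z" for x y z
  proof -
    note sub = R.submoduleE[OF R.grade_submodule]
    have c: "y \<in> carrier R" "z \<in> carrier R" "x \<in> carrier R" using that R.grade_closed by auto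
    note eo = eo[OF c(3)]
    have c': "e x \<in> carrier R" "o' x \<in> carrier R" using eo R.grade_closed by auto
    have "y \<oplus>\<^bsub>R\<^esub> z = e x \<oplus>\<^bsub>R\<^esub> o' x" using eo that by simp
    hence "y \<oplus>\<^bsub>R\<^esub> z \<oplus>\<^bsub>R\<^esub> (\<ominus>\<^bsub>R\<^esub> e x \<oplus>\<^bsub>R\<^esub> \<ominus>\<^bsub>R\<^esub> z) = e x \<oplus>\<^bsub>R\<^esub> o' x \<oplus>\<^bsub>R\<^esub> (\<ominus>\<^bsub>R\<^esub> e x \<oplus>\<^bsub>R\<^esub> \<ominus>\<^bsub>R\<^esub> z)" by simp
    moreover have "y \<oplus>\<^bsub>R\<^esub> z \<oplus>\<^bsub>R\<^esub> (\<ominus>\<^bsub>R\<^esub> e x \<oplus>\<^bsub>R\<^esub> \<ominus>\<^bsub>R\<^esub> z) = y \<ominus>\<^bsub>R\<^esub> e x"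
      using c c' by (simp add: a_minus_def R.M.a_ac R.M.r_neg R.M.r_neg1 R.M.r_neg2)
    moreover have "e x \<oplus>\<^bsub>R\<^esub> o' x \<oplus>\<^bsub>R\<^esub> (\<ominus>\<^bsub>R\<^esub> e x \<oplus>\<^bsub>R\<^esub> \<ominus>\<^bsub>R\<^esub> z) = o' x \<ominus>\<^bsub>R\<^esub> z"
      using c c' by (simp add: a_minus_def R.M.a_comm[of "e x" "o' x"] R.M.a_assoc R.M.r_neg2)
    ultimately have eq: "y \<ominus>\<^bsub>R\<^esub> e x = o' x \<ominus>\<^bsub>R\<^esub> z" by simp
    moreover have "y \<ominus>\<^bsub>R\<^esub> e x \<in> grade R 0" "o' x \<ominus>\<^bsub>R\<^esub> z \<in> grade R 1"
      using that eo sub by (auto simp: a_minus_def)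
    ultimately have "y \<ominus>\<^bsub>R\<^esub> e x = \<zero>\<^bsub>R\<^esub>" "o' x \<ominus>\<^bsub>R\<^esub> z = \<zero>\<^bsub>R\<^esub>" using R.grade_inter by auto
    thus ?thesis using c c' by (metis R.M.minus_eq R.M.minus_equality R.M.minus_minus R.M.a_inv_closed)
  qed
  have z: "\<zero>\<^bsub>R\<^esub> \<in> grade R p" for p
    using R.grade_submodule[of p] subgroup.one_closed submodule.axioms(1) by fastforce
  define M where "M x = (uea_m K R (e x), uea_m K R (o' x))" for x
  define H where "H x = (uea_h K R (e x), uea_h K R (o' x))" for x
  have e_add: "e (x \<oplus>\<^bsub>R\<^esub> y) = e x \<oplus>\<^bsub>R\<^esub> e y \<and> o' (x \<oplus>\<^bsub>R\<^esub> y) = o' x \<oplus>\<^bsub>R\<^esub> o' y"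
    if "x \<in> carrier R" "y \<in> carrier R" for x y
  proof (rule uniq)
    show "e x \<oplus>\<^bsub>R\<^esub> e y \<in> grade R 0" "o' x \<oplus>\<^bsub>R\<^esub> o' y \<in> grade R 1"
      using eo that R.submoduleE(5)[OF R.grade_submodule] by auto
    show "x \<oplus>\<^bsub>R\<^esub> y = e x \<oplus>\<^bsub>R\<^esub> e y \<oplus>\<^bsub>R\<^esub> (o' x \<oplus>\<^bsub>R\<^esub> o' y)"
    proof -
      have "e x \<in> carrier R" "e y \<in> carrier R" "o' x \<in> carrier R" "o' y \<in> carrier R"
        using eo that R.grade_closed by blast+
      hence "e x \<oplus>\<^bsub>R\<^esub> e y \<oplus>\<^bsub>R\<^esub> (o' x \<oplus>\<^bsub>R\<^esub> o' y) = (e x \<oplus>\<^bsub>R\<^esub> o' x) \<oplus>\<^bsub>R\<^esub> (e y \<oplus>\<^bsub>R\<^esub> o' y)"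
        by (simp add: R.M.a_ac)
      thus ?thesis using eo(3)[OF that(1)] eo(3)[OF that(2)] by simp
    qed
  qed
  have e_smult: "e (c \<odot>\<^bsub>R\<^esub> x) = c \<odot>\<^bsub>R\<^esub> e x \<and> o' (c \<odot>\<^bsub>R\<^esub> x) = c \<odot>\<^bsub>R\<^esub> o' x"
    if "c \<in> carrier K" "x \<in> carrier R" for c x
  proof (rule uniq)
    show "c \<odot>\<^bsub>R\<^esub> e x \<in> grade R 0" "c \<odot>\<^bsub>R\<^esub> o' x \<in> grade R 1"
      using eo that R.submoduleE(4)[OF R.grade_submodule] by auto
    have "e x \<in> carrier R" "o' x \<in> carrier R" using eo that R.grade_closed by blast+
    thus "c \<odot>\<^bsub>R\<^esub> x = c \<odot>\<^bsub>R\<^esub> e x \<oplus>\<^bsub>R\<^esub> c \<odot>\<^bsub>R\<^esub> o' x"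
      using R.smult_r_distr[OF that(1)] eo(3)[OF that(2)] by metis
  qed
  have e_mult: "e (x \<otimes>\<^bsub>R\<^esub> y) = e x \<otimes>\<^bsub>R\<^esub> e y \<oplus>\<^bsub>R\<^esub> o' x \<otimes>\<^bsub>R\<^esub> o' y
      \<and> o' (x \<otimes>\<^bsub>R\<^esub> y) = e x \<otimes>\<^bsub>R\<^esub> o' y \<oplus>\<^bsub>R\<^esub> o' x \<otimes>\<^bsub>R\<^esub> e y"
    if "x \<in> carrier R" "y \<in> carrier R" for x y
  proof (rule uniq)
    note x = eo[OF that(1)] and y = eo[OF that(2)]
    show "e x \<otimes>\<^bsub>R\<^esub> e y \<oplus>\<^bsub>R\<^esub> o' x \<otimes>\<^bsub>R\<^esub> o' y \<in> grade R 0"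
      using R.grade_mult[OF x(1) y(1)] R.grade_mult[OF x(2) y(2)] R.submoduleE(5)[OF R.grade_submodule] by simp
    show "e x \<otimes>\<^bsub>R\<^esub> o' y \<oplus>\<^bsub>R\<^esub> o' x \<otimes>\<^bsub>R\<^esub> e y \<in> grade R 1"
      using R.grade_mult[OF x(1) y(2)] R.grade_mult[OF x(2) y(1)] R.submoduleE(5)[OF R.grade_submodule] by simp
    have "e x \<in> carrier R" "e y \<in> carrier R" "o' x \<in> carrier R" "o' y \<in> carrier R"
      using x y R.grade_closed by blast+
    hence "(e x \<oplus>\<^bsub>R\<^esub> o' x) \<otimes>\<^bsub>R\<^esub> (e y \<oplus>\<^bsub>R\<^esub> o' y)
      = e x \<otimes>\<^bsub>R\<^esub> e y \<oplus>\<^bsub>R\<^esub> o' x \<otimes>\<^bsub>R\<^esub> o' y \<oplus>\<^bsub>R\<^esub> (e x \<otimes>\<^bsub>R\<^esub> o' y \<oplus>\<^bsub>R\<^esub> o' x \<otimes>\<^bsub>R\<^esub> e y)"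
      by (simp add: R.A.l_distr R.A.r_distr R.M.a_ac)
    thus "x \<otimes>\<^bsub>R\<^esub> y = e x \<otimes>\<^bsub>R\<^esub> e y \<oplus>\<^bsub>R\<^esub> o' x \<otimes>\<^bsub>R\<^esub> o' y \<oplus>\<^bsub>R\<^esub> (e x \<otimes>\<^bsub>R\<^esub> o' y \<oplus>\<^bsub>R\<^esub> o' x \<otimes>\<^bsub>R\<^esub> e y)"
      using x(3) y(3) by simp
  qed
  have e_one: "e \<one>\<^bsub>R\<^esub> = \<one>\<^bsub>R\<^esub> \<and> o' \<one>\<^bsub>R\<^esub> = \<zero>\<^bsub>R\<^esub>"
    by (rule uniq) (auto simp: R.grade_one z)
  have mh_c: "uea_m K R x \<in> carrier ?U" "uea_h K R x \<in> carrier ?U" if "x \<in> carrier R" for x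
    using that by (auto simp: uea_m_def uea_h_def R.UEA_simps)
  have mh_add: "uea_m K R (x \<oplus>\<^bsub>R\<^esub> y) = uea_m K R x \<oplus>\<^bsub>?U\<^esub> uea_m K R y"
      "uea_h K R (x \<oplus>\<^bsub>R\<^esub> y) = uea_h K R x \<oplus>\<^bsub>?U\<^esub> uea_h K R y" 
      "uea_m K R (x \<otimes>\<^bsub>R\<^esub> y) = uea_m K R x \<otimes>\<^bsub>?U\<^esub> uea_m K R y" if "x \<in> carrier R" "y \<in> carrier R" for x y
    using pre that by (auto simp: pre_property_P_def algebra_hom_def ring_hom_def linear_maps_def)
  have mh_smult: "uea_m K R (c \<odot>\<^bsub>R\<^esub> x) = c \<odot>\<^bsub>?U\<^esub> uea_m K R x"
      "uea_h K R (c \<odot>\<^bsub>R\<^esub> x) = c \<odot>\<^bsub>?U\<^esub> uea_h K R x" if "c \<in> carrier K" "x \<in> carrier R" for c x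
    using pre that by (auto simp: pre_property_P_def algebra_hom_def ring_hom_def linear_maps_def)
  have mh_zero: "uea_m K R \<zero>\<^bsub>R\<^esub> = \<zero>\<^bsub>?U\<^esub>" "uea_h K R \<zero>\<^bsub>R\<^esub> = \<zero>\<^bsub>?U\<^esub>"
    using mh_smult[of "\<zero>\<^bsub>K\<^esub>" "\<zero>\<^bsub>R\<^esub>"] mh_c by auto
  have m_one: "uea_m K R \<one>\<^bsub>R\<^esub> = \<one>\<^bsub>?U\<^esub>"
    using pre by (auto simp: pre_property_P_def algebra_hom_def ring_hom_def)
  have c: "e x \<in> carrier R" "o' x \<in> carrier R" if "x \<in> carrier R" for x
    using eo[OF that] R.grade_closed by blast+
  have val: "M x = in_parity ?U p (uea_m K R x)" "H x = in_parity ?U p (uea_h K R x)"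
    if "x \<in> grade R p" for p x
  proof -
    have xc: "x \<in> carrier R" using that R.grade_closed by blast
    have "(p = 0 \<longrightarrow> e x = x \<and> o' x = \<zero>\<^bsub>R\<^esub>) \<and> (p = 1 \<longrightarrow> e x = \<zero>\<^bsub>R\<^esub> \<and> o' x = x)"
      using uniq[of x "\<zero>\<^bsub>R\<^esub>" x] uniq[of "\<zero>\<^bsub>R\<^esub>" x x] z that xc by auto
    thus "M x = in_parity ?U p (uea_m K R x)" "H x = in_parity ?U p (uea_h K R x)"
      by (cases "p = 0"; auto simp: M_def H_def in_parity_def mh_zero)+
  qed
  have ip_c: "in_parity ?U p u \<in> carrier D" if "u \<in> carrier ?U" for p u
    using that by (simp add: D_def double_alg_def in_parity_def)
  have ip_mult: "in_parity ?U p u \<otimes>\<^bsub>D\<^esub> in_parity ?U q v = in_parity ?U (p + q) (u \<otimes>\<^bsub>?U\<^esub> v)"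
    if "u \<in> carrier ?U" "v \<in> carrier ?U" for p q u v
    using that by (cases "p = 0"; cases "q = 0"; simp add: D_def double_alg_def in_parity_def)
  have ip_add: "in_parity ?U p u \<oplus>\<^bsub>D\<^esub> in_parity ?U p v = in_parity ?U p (u \<oplus>\<^bsub>?U\<^esub> v)"
    if "u \<in> carrier ?U" "v \<in> carrier ?U" for p u v
    using that by (cases "p = 0"; simp add: D_def double_alg_def in_parity_def)
  have ip_smult: "k \<odot>\<^bsub>D\<^esub> in_parity ?U p u = in_parity ?U p (k \<odot>\<^bsub>?U\<^esub> u)"
    if "k \<in> carrier K" "u \<in> carrier ?U" for p k u
    using that by (cases "p = 0"; simp add: D_def double_alg_def in_parity_def)
  have ip_minus: "\<ominus>\<^bsub>D\<^esub> in_parity ?U p u = in_parity ?U p (\<ominus>\<^bsub>?U\<^esub> u)" if "u \<in> carrier ?U" for p u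
    using ip_smult[of "\<ominus>\<^bsub>K\<^esub> \<one>\<^bsub>K\<^esub>" u p] that ip_c[OF that] by (simp add: D.smult_l_minus U.smult_l_minus)
  have comm: "gr_commutator K D p q (in_parity ?U p u) (in_parity ?U q v)
      = in_parity ?U (p + q) (gr_commutator K ?U p q u v)"
    if "u \<in> carrier ?U" "v \<in> carrier ?U" for p q u v
    unfolding gr_commutator_def a_minus_def using that
    by (simp add: ip_mult ip_smult ip_minus ip_add add.commute[of q p] del: mult_bit_eq_and add_bit_eq_xor)
  have "pre_property_P K R D M H"
    unfolding pre_property_P_def
  proof (intro conjI allI ballI)
    show "assoc_algebra K D" by unfold_locales
    show "M \<in> algebra_hom K R D"
      unfolding algebra_hom_def ring_hom_def linear_maps_def
      by (auto simp: M_def D_def double_alg_def mh_c c e_add e_mult e_one e_smult mh_add mh_smult mh_zero m_one)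
    show "H \<in> linear_maps K R D"
      unfolding linear_maps_def
      by (auto simp: H_def D_def double_alg_def mh_c c e_add e_smult mh_add mh_smult)
    fix p q x y assume xy: "x \<in> grade R p" "y \<in> grade R q"
    hence xyc: "x \<in> carrier R" "y \<in> carrier R" using R.grade_closed by auto
    note v = val[OF xy(1)] val[OF xy(2)] val[OF R.bracket_even[OF xy]] val[OF R.grade_mult[OF xy]]
    have rel: "uea_h K R (pbracket R x y) = gr_commutator K ?U p q (uea_h K R x) (uea_h K R y)"
      "uea_m K R (pbracket R x y) = gr_commutator K ?U p q (uea_h K R x) (uea_m K R y)"
      "uea_h K R (x \<otimes>\<^bsub>R\<^esub> y) = uea_m K R x \<otimes>\<^bsub>?U\<^esub> uea_h K R y
        \<oplus>\<^bsub>?U\<^esub> ksgn K (p * q) \<odot>\<^bsub>?U\<^esub> (uea_m K R y \<otimes>\<^bsub>?U\<^esub> uea_h K R x)"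
      using pre xy unfolding pre_property_P_def by blast+
    show "H (pbracket R x y) = gr_commutator K D p q (H x) (H y)"
      "M (pbracket R x y) = gr_commutator K D p q (H x) (M y)"
      using v rel comm mh_c xyc by (simp_all del: mult_bit_eq_and add_bit_eq_xor)
    show "H (x \<otimes>\<^bsub>R\<^esub> y) = M x \<otimes>\<^bsub>D\<^esub> H y \<oplus>\<^bsub>D\<^esub> ksgn K (p * q) \<odot>\<^bsub>D\<^esub> (M y \<otimes>\<^bsub>D\<^esub> H x)"
      using v rel(3) mh_c xyc
      by (simp add: ip_mult ip_smult ip_add add.commute[of q p] del: mult_bit_eq_and add_bit_eq_xor)
  qed
  with val show ?thesis by blast
qed

lemma UEA_superalgebra:
  assumes R: "poisson_superalgebra K R"
  shows "superalgebra K (UEA K R)"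
proof -
  interpret R: poisson_superalgebra K R by (rule R)
  let ?U = "UEA K R"
  interpret U: assoc_algebra K ?U by (rule R.UEA_assoc_algebra)
  obtain M H where P: "pre_property_P K R (double_alg ?U) M H"
    and val: "\<And>p x. x \<in> grade R p \<Longrightarrow> M x = in_parity ?U p (uea_m K R x)"
      "\<And>p x. x \<in> grade R p \<Longrightarrow> H x = in_parity ?U p (uea_h K R x)"
    using double_pre[OF R] by blast
  define ev where "ev = uea_eval (double_alg ?U) M H"
  have cl: "uea_class K R t \<in> carrier ?U" if "t \<in> uea_terms K R" for t
    using that by (simp add: R.UEA_simps)
  have ev_homog: "ev t = in_parity ?U p (uea_class K R t)" if "uea_homog R p t" "t \<in> uea_terms K R" for p t
    using that
  proof (induction rule: uea_homog.induct)
    case (6 p s q t)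
    hence "ev s = in_parity ?U p (uea_class K R s)" "ev t = in_parity ?U q (uea_class K R t)"
      "uea_class K R s \<in> carrier ?U" "uea_class K R t \<in> carrier ?U"
      "uea_class K R (Times s t) = uea_class K R s \<otimes>\<^bsub>?U\<^esub> uea_class K R t"
      by (simp_all add: cl R.UEA_simps(5))
    thus ?case
      by (cases "p = 0"; cases "q = 0"; simp add: ev_def in_parity_def double_alg_def)
  next
    case (5 p s t)
    hence "ev s = in_parity ?U p (uea_class K R s)" "ev t = in_parity ?U p (uea_class K R t)"
      "uea_class K R s \<in> carrier ?U" "uea_class K R t \<in> carrier ?U"
      "uea_class K R (Plus s t) = uea_class K R s \<oplus>\<^bsub>?U\<^esub> uea_class K R t"
      by (simp_all add: cl R.UEA_simps(6))
    thus ?case by (cases "p = 0"; simp add: ev_def in_parity_def double_alg_def)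
  next
    case (7 p s c)
    hence "ev s = in_parity ?U p (uea_class K R s)" "c \<in> carrier K"
      "uea_class K R s \<in> carrier ?U"
      "uea_class K R (Scal c s) = c \<odot>\<^bsub>?U\<^esub> uea_class K R s"
      by (simp_all add: cl R.UEA_simps(7))
    thus ?case by (cases "p = 0"; simp add: ev_def in_parity_def double_alg_def)
  qed (simp_all add: ev_def val uea_m_def uea_h_def in_parity_def double_alg_def
         R.UEA_simps(2,3))
  have sub: "submodule (grade ?U p) K ?U" for p
  proof (rule U.submoduleI)
    show "grade ?U p \<subseteq> carrier ?U" by (auto simp: R.UEA_simps)
    show "\<zero>\<^bsub>?U\<^esub> \<in> grade ?U p" by (auto simp: R.UEA_simps intro!: imageI uea_homog.intros)
    show sm: "c \<odot>\<^bsub>?U\<^esub> x \<in> grade ?U p" if "c \<in> carrier K" "x \<in> grade ?U p" for c x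
      using that by (auto simp: R.UEA_simps intro!: imageI uea_homog.intros)
    show "x \<oplus>\<^bsub>?U\<^esub> y \<in> grade ?U p" if "x \<in> grade ?U p" "y \<in> grade ?U p" for x y
      using that by (auto simp: R.UEA_simps intro!: imageI uea_homog.intros)
    show "\<ominus>\<^bsub>?U\<^esub> x \<in> grade ?U p" if "x \<in> grade ?U p" for x
    proof -
      have "x \<in> carrier ?U" using that by (auto simp: R.UEA_simps)
      thus ?thesis using sm[OF _ that, of "\<ominus>\<^bsub>K\<^esub> \<one>\<^bsub>K\<^esub>"] by (simp add: U.smult_l_minus)
    qed
  qed
  have mult: "x \<otimes>\<^bsub>?U\<^esub> y \<in> grade ?U (p + q)" if "x \<in> grade ?U p" "y \<in> grade ?U q" for x y p q
    using that by (auto simp: R.UEA_simps intro!: imageI uea_homog.intros simp del: add_bit_eq_xor)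
  have sum: "\<exists>y\<in>grade ?U 0. \<exists>z\<in>grade ?U 1. uea_class K R t = y \<oplus>\<^bsub>?U\<^esub> z" if "t \<in> uea_terms K R" for t
    using that
  proof (induction t)
    case (Mgen x)
    hence "x \<in> carrier R" by simp
    then obtain y z where yz: "y \<in> grade R 0" "z \<in> grade R 1" "x = y \<oplus>\<^bsub>R\<^esub> z"
      using R.grade_sum by blast
    hence c: "y \<in> carrier R" "z \<in> carrier R" using R.grade_closed by auto
    have "uea_class K R (Mgen y) \<in> grade ?U 0" "uea_class K R (Mgen z) \<in> grade ?U 1"
      using yz c by (auto simp: R.UEA_simps intro!: imageI uea_homog.intros)
    moreover have "uea_class K R (Mgen x) = uea_class K R (Mgen y) \<oplus>\<^bsub>?U\<^esub> uea_class K R (Mgen z)"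
      using yz c R.uea_class_eqI[OF uea_eq.m_add[OF c]] by (simp add: R.UEA_simps)
    ultimately show ?case by blast
  next
    case (Hgen x)
    hence "x \<in> carrier R" by simp
    then obtain y z where yz: "y \<in> grade R 0" "z \<in> grade R 1" "x = y \<oplus>\<^bsub>R\<^esub> z"
      using R.grade_sum by blast
    hence c: "y \<in> carrier R" "z \<in> carrier R" using R.grade_closed by auto
    have "uea_class K R (Hgen y) \<in> grade ?U 0" "uea_class K R (Hgen z) \<in> grade ?U 1"
      using yz c by (auto simp: R.UEA_simps intro!: imageI uea_homog.intros)
    moreover have "uea_class K R (Hgen x) = uea_class K R (Hgen y) \<oplus>\<^bsub>?U\<^esub> uea_class K R (Hgen z)"
      using yz c R.uea_class_eqI[OF uea_eq.h_add[OF c]] by (simp add: R.UEA_simps)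
    ultimately show ?case by blast
  next
    case Zero
    have "\<zero>\<^bsub>?U\<^esub> \<in> grade ?U p" for p by (auto simp: R.UEA_simps intro!: imageI uea_homog.intros)
    thus ?case by (intro bexI[of _ "\<zero>\<^bsub>?U\<^esub>"]) (auto simp flip: R.UEA_simps(3))
  next
    case One
    have "\<zero>\<^bsub>?U\<^esub> \<in> grade ?U 1" "\<one>\<^bsub>?U\<^esub> \<in> grade ?U 0"
      by (auto simp: R.UEA_simps intro!: imageI uea_homog.intros)
    thus ?case by (intro bexI[of _ "\<zero>\<^bsub>?U\<^esub>"] bexI[of _ "\<one>\<^bsub>?U\<^esub>"]) (auto simp flip: R.UEA_simps(2))
  next
    case (Plus s t)
    then obtain a b c d where h: "a \<in> grade ?U 0" "b \<in> grade ?U 1" "uea_class K R s = a \<oplus>\<^bsub>?U\<^esub> b"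
      "c \<in> grade ?U 0" "d \<in> grade ?U 1" "uea_class K R t = c \<oplus>\<^bsub>?U\<^esub> d" by auto
    have cc: "a \<in> carrier ?U" "b \<in> carrier ?U" "c \<in> carrier ?U" "d \<in> carrier ?U"
      using h U.submoduleE(1)[OF sub] by blast+
    have "uea_class K R (Plus s t) = (a \<oplus>\<^bsub>?U\<^esub> b) \<oplus>\<^bsub>?U\<^esub> (c \<oplus>\<^bsub>?U\<^esub> d)"
      using Plus.prems h(3,6) by (simp flip: R.UEA_simps(6))
    also have "\<dots> = (a \<oplus>\<^bsub>?U\<^esub> c) \<oplus>\<^bsub>?U\<^esub> (b \<oplus>\<^bsub>?U\<^esub> d)" using cc by (simp add: U.M.a_ac)
    finally show ?case using h U.submoduleE(5)[OF sub] by blast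
  next
    case (Times s t)
    then obtain a b c d where h: "a \<in> grade ?U 0" "b \<in> grade ?U 1" "uea_class K R s = a \<oplus>\<^bsub>?U\<^esub> b"
      "c \<in> grade ?U 0" "d \<in> grade ?U 1" "uea_class K R t = c \<oplus>\<^bsub>?U\<^esub> d" by auto
    have cc: "a \<in> carrier ?U" "b \<in> carrier ?U" "c \<in> carrier ?U" "d \<in> carrier ?U"
      using h U.submoduleE(1)[OF sub] by blast+
    have "uea_class K R (Times s t) = (a \<oplus>\<^bsub>?U\<^esub> b) \<otimes>\<^bsub>?U\<^esub> (c \<oplus>\<^bsub>?U\<^esub> d)"
      using Times.prems h(3,6) by (simp flip: R.UEA_simps(5))
    also have "\<dots> = (a \<otimes>\<^bsub>?U\<^esub> c \<oplus>\<^bsub>?U\<^esub> b \<otimes>\<^bsub>?U\<^esub> d) \<oplus>\<^bsub>?U\<^esub> (a \<otimes>\<^bsub>?U\<^esub> d \<oplus>\<^bsub>?U\<^esub> b \<otimes>\<^bsub>?U\<^esub> c)"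
      using cc by (simp add: U.A.l_distr U.A.r_distr U.M.a_ac)
    moreover have "a \<otimes>\<^bsub>?U\<^esub> c \<oplus>\<^bsub>?U\<^esub> b \<otimes>\<^bsub>?U\<^esub> d \<in> grade ?U 0" "a \<otimes>\<^bsub>?U\<^esub> d \<oplus>\<^bsub>?U\<^esub> b \<otimes>\<^bsub>?U\<^esub> c \<in> grade ?U 1"
      using mult[OF h(1) h(4)] mult[OF h(2) h(5)] mult[OF h(1) h(5)] mult[OF h(2) h(4)]
        U.submoduleE(5)[OF sub] by simp_all
    ultimately show ?case by auto
  next
    case (Scal k s)
    then obtain a b where h: "a \<in> grade ?U 0" "b \<in> grade ?U 1" "uea_class K R s = a \<oplus>\<^bsub>?U\<^esub> b" by auto
    have cc: "a \<in> carrier ?U" "b \<in> carrier ?U" using h U.submoduleE(1)[OF sub] by blast+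
    have "uea_class K R (Scal k s) = k \<odot>\<^bsub>?U\<^esub> a \<oplus>\<^bsub>?U\<^esub> k \<odot>\<^bsub>?U\<^esub> b"
      using Scal.prems h(3) cc by (simp add: U.smult_r_distr flip: R.UEA_simps(7))
    thus ?case using h Scal.prems U.submoduleE(4)[OF sub, of k] by (metis uea_terms_simps(7))
  qed
  have inter: "x = \<zero>\<^bsub>?U\<^esub>" if "x \<in> grade ?U 0" "x \<in> grade ?U 1" for x
  proof -
    obtain s t where st: "s \<in> uea_terms K R" "uea_homog R 0 s" "x = uea_class K R s"
      "t \<in> uea_terms K R" "uea_homog R 1 t" "x = uea_class K R t"
      using \<open>x \<in> grade ?U 0\<close> \<open>x \<in> grade ?U 1\<close> by (auto simp: R.UEA_simps)
    hence "uea_eq K R s t" by (metis R.uea_class_eq_iff)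
    hence "ev s = ev t" unfolding ev_def by (rule R.uea_eval_cong[OF P])
    thus ?thesis using st by (simp add: ev_homog in_parity_def)
  qed
  show ?thesis
  proof (intro superalgebra.intro superalgebra_axioms.intro R.UEA_assoc_algebra sub mult)
    show "grade ?U 0 \<inter> grade ?U 1 = {\<zero>\<^bsub>?U\<^esub>}"
      using inter by (auto simp: R.UEA_simps intro!: imageI uea_homog.intros)
    show "\<one>\<^bsub>?U\<^esub> \<in> grade ?U 0" by (auto simp: R.UEA_simps intro!: imageI uea_homog.intros)
  qed (use sum in \<open>auto simp: R.UEA_simps(1)\<close>)
qed

theorem UEA_universal:
  fixes K :: "('k, 'l) ring_scheme" and R :: "('k, 'a, 'm) poisson_superalg_scheme"
    and B :: "('k, 'b, 'n) superalg_scheme"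
  assumes R: "poisson_superalgebra K R"
  shows "property_P K R (UEA K R) (uea_m K R) (uea_h K R)"
    and "property_P K R B \<gamma> \<delta> \<Longrightarrow>
      \<exists>\<phi>\<in>superalgebra_hom K (UEA K R) B.
        (\<forall>r\<in>carrier R. \<phi> (uea_m K R r) = \<gamma> r \<and> \<phi> (uea_h K R r) = \<delta> r)"
    and "\<lbrakk>property_P K R B \<gamma> \<delta>;
        \<phi> \<in> superalgebra_hom K (UEA K R) B; \<psi> \<in> superalgebra_hom K (UEA K R) B;
        \<And>r. r \<in> carrier R \<Longrightarrow> \<phi> (uea_m K R r) = \<gamma> r \<and> \<phi> (uea_h K R r) = \<delta> r;
        \<And>r. r \<in> carrier R \<Longrightarrow> \<psi> (uea_m K R r) = \<gamma> r \<and> \<psi> (uea_h K R r) = \<delta> r;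
        u \<in> carrier (UEA K R)\<rbrakk> \<Longrightarrow> \<phi> u = \<psi> u"
proof -
  interpret R: poisson_superalgebra K R by (rule R)
  let ?U = "UEA K R"
  interpret U: assoc_algebra K ?U by (rule R.UEA_assoc_algebra)
  have "uea_m K R \<in> even_maps R ?U" "uea_h K R \<in> even_maps R ?U"
    by (auto simp: even_maps_def R.UEA_simps uea_m_def uea_h_def R.grade_closed intro!: imageI uea_homog.intros)
  thus "property_P K R ?U (uea_m K R) (uea_h K R)"
    using R.UEA_pre UEA_superalgebra[OF R]
    unfolding property_P_def pre_property_P_def superalgebra_hom_def by blast
  show "\<exists>\<phi>\<in>superalgebra_hom K ?U B. (\<forall>r\<in>carrier R. \<phi> (uea_m K R r) = \<gamma> r \<and> \<phi> (uea_h K R r) = \<delta> r)"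
    if P: "property_P K R B \<gamma> \<delta>"
  proof -
    have pre: "pre_property_P K R B \<gamma> \<delta>"
      using P superalgebra.axioms(1) unfolding property_P_def pre_property_P_def superalgebra_hom_def by blast
    interpret B: superalgebra K B using P by (simp add: property_P_def)
    define \<phi> where "\<phi> X = uea_eval B \<gamma> \<delta> (uea_rep X)" for X
    have ph: "\<phi> (uea_class K R t) = uea_eval B \<gamma> \<delta> t" if "t \<in> uea_terms K R" for t
      unfolding \<phi>_def by (rule R.uea_eval_rep[OF pre that])
    have g: "\<gamma> x \<in> grade B p" "\<delta> x \<in> grade B p" if "x \<in> grade R p" for x p
      using P that unfolding property_P_def superalgebra_hom_def even_maps_def by blast+
    have hom: "uea_eval B \<gamma> \<delta> t \<in> grade B p" if "uea_homog R p t" "t \<in> uea_terms K R" for p t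
      using that
    proof (induction rule: uea_homog.induct)
      case (3 p)
      then show ?case using B.grade_submodule[of p] subgroup.one_closed submodule.axioms(1) by fastforce
    qed (use g B.grade_one B.grade_mult B.submoduleE(4,5)[OF B.grade_submodule] in
        \<open>simp_all del: add_bit_eq_xor\<close>)
    have "\<phi> \<in> superalgebra_hom K ?U B"
      unfolding superalgebra_hom_def algebra_hom_def ring_hom_def linear_maps_def even_maps_def
      by (auto simp: R.UEA_simps ph R.uea_eval_closed[OF pre] hom)
    moreover have "\<phi> (uea_m K R r) = \<gamma> r \<and> \<phi> (uea_h K R r) = \<delta> r" if "r \<in> carrier R" for r
      using that by (simp add: uea_m_def uea_h_def ph)
    ultimately show ?thesis by blast
  qed
  show "\<phi> u = \<psi> u" if P: "property_P K R B \<gamma> \<delta>"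
    and hom: "\<phi> \<in> superalgebra_hom K ?U B" "\<psi> \<in> superalgebra_hom K ?U B"
    and v: "\<And>r. r \<in> carrier R \<Longrightarrow> \<phi> (uea_m K R r) = \<gamma> r \<and> \<phi> (uea_h K R r) = \<delta> r"
      "\<And>r. r \<in> carrier R \<Longrightarrow> \<psi> (uea_m K R r) = \<gamma> r \<and> \<psi> (uea_h K R r) = \<delta> r"
    and u: "u \<in> carrier ?U"
  proof -
    interpret B: superalgebra K B using P by (simp add: property_P_def)
    have zero: "\<chi> \<zero>\<^bsub>?U\<^esub> = \<zero>\<^bsub>B\<^esub>" if "\<chi> \<in> superalgebra_hom K ?U B" for \<chi>
      using that ring_hom_zero[OF _ U.ring_axioms B.ring_axioms, of \<chi>]
      by (simp add: superalgebra_hom_def algebra_hom_def)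
    have "\<phi> (uea_class K R t) = \<psi> (uea_class K R t)" if "t \<in> uea_terms K R" for t
      using that
    proof (induction t)
      case Zero
      show ?case using zero[OF hom(1)] zero[OF hom(2)] by (simp flip: R.UEA_simps(3))
    qed (use hom v in \<open>auto simp: superalgebra_hom_def algebra_hom_def ring_hom_def linear_maps_def
           R.UEA_simps(1) uea_m_def uea_h_def simp flip: R.UEA_simps(2) R.UEA_simps(5-7)\<close>)
    thus ?thesis using u by (auto simp: R.UEA_simps)
  qed
qed


section \<open>The ring structure of an Ore extension\<close>


locale ore_data = ring T for T :: "('k, 't, 'm) superalg_scheme" (structure) +
  fixes \<sigma> \<eta> :: "'t \<Rightarrow> 't"
  assumes sigma: "\<sigma> \<in> ring_hom T T" and eta: "sigma_derivation T \<sigma> \<eta>"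
begin

abbreviation "Y \<equiv> ore_shift T \<sigma> \<eta>"
abbreviation "S \<equiv> ore_ext T \<sigma> \<eta>"

lemma sigma_simps [simp]:
  "x \<in> carrier T \<Longrightarrow> \<sigma> x \<in> carrier T"
  "\<lbrakk>x \<in> carrier T; y \<in> carrier T\<rbrakk> \<Longrightarrow> \<sigma> (x \<oplus> y) = \<sigma> x \<oplus> \<sigma> y"
  "\<lbrakk>x \<in> carrier T; y \<in> carrier T\<rbrakk> \<Longrightarrow> \<sigma> (x \<otimes> y) = \<sigma> x \<otimes> \<sigma> y"
  "\<sigma> \<one> = \<one>" "\<sigma> \<zero> = \<zero>"
  using sigma ring_hom_zero[OF sigma ring_axioms ring_axioms] by (auto simp: ring_hom_def)

lemma eta_simps [simp]:
  "x \<in> carrier T \<Longrightarrow> \<eta> x \<in> carrier T"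
  "\<lbrakk>x \<in> carrier T; y \<in> carrier T\<rbrakk> \<Longrightarrow> \<eta> (x \<oplus> y) = \<eta> x \<oplus> \<eta> y"
  "\<lbrakk>x \<in> carrier T; y \<in> carrier T\<rbrakk> \<Longrightarrow> \<eta> (x \<otimes> y) = \<sigma> x \<otimes> \<eta> y \<oplus> \<eta> x \<otimes> y"
  using eta by (auto simp: sigma_derivation_def)

lemma eta_zero_one [simp]: "\<eta> \<zero> = \<zero>" "\<eta> \<one> = \<zero>"
proof -
  show "\<eta> \<zero> = \<zero>" using eta_simps(2)[of \<zero> \<zero>] by (metis add.l_cancel_one' eta_simps(1) l_zero zero_closed)
  show "\<eta> \<one> = \<zero>" using eta_simps(3)[of \<one> \<one>] by (metis add.l_cancel_one' eta_simps(1) l_one r_one one_closed sigma_simps(4))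
qed

lemma up_iff: "p \<in> up T \<longleftrightarrow> (\<forall>n. p n \<in> carrier T) \<and> (\<exists>N. \<forall>n>N. p n = \<zero>)"
  by (auto simp: up_def bound_def)

lemma up_c [simp]: "p \<in> up T \<Longrightarrow> p n \<in> carrier T"
  by (simp add: up_iff)

lemma up_supp: "p \<in> up T \<Longrightarrow> finite {i. p i \<noteq> \<zero>}"
proof -
  assume "p \<in> up T"
  then obtain N where "\<forall>n>N. p n = \<zero>" by (auto simp: up_iff)
  hence "{i. p i \<noteq> \<zero>} \<subseteq> {..N}" by (auto simp: not_less[symmetric])
  thus ?thesis by (rule finite_subset) simp
qed

lemma Y_up [simp]: assumes p: "p \<in> up T" shows "Y p \<in> up T"
proof -
  obtain N where N: "\<forall>n>N. p n = \<zero>" using p by (auto simp: up_iff)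
  have "\<forall>n>Suc N. Y p n = \<zero>"
    using N by (auto simp: ore_shift_def split: nat.split)
  moreover have "Y p n \<in> carrier T" for n
    using p by (simp add: up_iff ore_shift_def split: nat.split)
  ultimately show ?thesis unfolding up_iff by blast
qed

lemma Yn_up [simp]: "p \<in> up T \<Longrightarrow> (Y ^^ i) p \<in> up T"
  by (induction i) auto

lemma up_add [simp]: "p \<in> up T \<Longrightarrow> q \<in> up T \<Longrightarrow> (\<lambda>n. p n \<oplus> q n) \<in> up T"
  by (rule up_add_closed)

lemma up_scal [simp]: "t \<in> carrier T \<Longrightarrow> q \<in> up T \<Longrightarrow> (\<lambda>n. t \<otimes> q n) \<in> up T"
  by (rule up_smult_closed)

lemma up_zero [simp]: "(\<lambda>n. \<zero>) \<in> up T"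
  by (auto simp: up_iff)

lemma up_finsum [simp]:
  assumes "finite I" "\<And>i. i \<in> I \<Longrightarrow> f i \<in> up T"
  shows "(\<lambda>n. \<Oplus>i\<in>I. f i n) \<in> up T"
  using assms by (induction I rule: finite_induct) (auto simp: Pi_def)

lemma Y_add: "p \<in> up T \<Longrightarrow> q \<in> up T \<Longrightarrow> Y (\<lambda>n. p n \<oplus> q n) = (\<lambda>n. Y p n \<oplus> Y q n)"
  by (rule ext) (auto simp: ore_shift_def a_ac split: nat.split)

lemma Yn_add: "p \<in> up T \<Longrightarrow> q \<in> up T \<Longrightarrow> (Y ^^ i) (\<lambda>n. p n \<oplus> q n) = (\<lambda>n. (Y ^^ i) p n \<oplus> (Y ^^ i) q n)"
  by (induction i) (auto simp: Y_add)

lemma Y_scal: "t \<in> carrier T \<Longrightarrow> q \<in> up T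
    \<Longrightarrow> Y (\<lambda>n. t \<otimes> q n) = (\<lambda>n. \<sigma> t \<otimes> Y q n \<oplus> \<eta> t \<otimes> q n)"
  by (rule ext) (auto simp: ore_shift_def r_distr a_ac split: nat.split)

lemma Y_zero: "Y (\<lambda>n. \<zero>) = (\<lambda>n. \<zero>)"
  by (rule ext) (auto simp: ore_shift_def split: nat.split)

lemma Y_finsum:
  assumes "finite I" "\<And>i. i \<in> I \<Longrightarrow> c i \<in> carrier T" "\<And>i. i \<in> I \<Longrightarrow> f i \<in> up T"
  shows "Y (\<lambda>n. \<Oplus>i\<in>I. c i \<otimes> f i n) = (\<lambda>n. \<Oplus>i\<in>I. \<sigma> (c i) \<otimes> Y (f i) n \<oplus> \<eta> (c i) \<otimes> f i n)"
  using assms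
  by (induction I rule: finite_induct) (auto simp: Pi_def Y_zero Y_add Y_scal a_ac)

definition mul :: "(nat \<Rightarrow> 't) \<Rightarrow> (nat \<Rightarrow> 't) \<Rightarrow> nat \<Rightarrow> 't" where
  "mul p q = (\<lambda>n. \<Oplus>i\<in>{i. p i \<noteq> \<zero>}. p i \<otimes> (Y ^^ i) q n)"

lemma mul_eq:
  assumes "p \<in> up T" "q \<in> up T" "\<forall>n>N. p n = \<zero>"
  shows "mul p q n = (\<Oplus>i\<in>{..N}. p i \<otimes> (Y ^^ i) q n)"
  unfolding mul_def
  by (rule add.finprod_mono_neutral_cong_left) (use assms in \<open>auto simp: not_less[symmetric]\<close>)

lemma mul_up [simp]: "p \<in> up T \<Longrightarrow> q \<in> up T \<Longrightarrow> mul p q \<in> up T"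
  unfolding mul_def by (rule up_finsum) (auto simp: up_supp)

lemma common_bound:
  assumes "p \<in> up T" "q \<in> up T"
  obtains N where "\<forall>n>N. p n = \<zero>" "\<forall>n>N. q n = \<zero>"
proof -
  obtain M M' where "\<forall>n>M. p n = \<zero>" "\<forall>n>M'. q n = \<zero>" using assms by (auto simp: up_iff)
  thus thesis by (intro that[of "max M M'"]) auto
qed

lemma mul_add_left:
  assumes "p \<in> up T" "q \<in> up T" "r \<in> up T"
  shows "mul (\<lambda>n. p n \<oplus> q n) r = (\<lambda>n. mul p r n \<oplus> mul q r n)"
proof -
  obtain N where N: "\<forall>n>N. p n = \<zero>" "\<forall>n>N. q n = \<zero>" using assms common_bound by blast
  show ?thesis
    by (rule ext) (use assms N in \<open>simp add: mul_eq[where N = N] l_distr finsum_addf Pi_def\<close>)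
qed

lemma mul_add_right:
  assumes "p \<in> up T" "q \<in> up T" "r \<in> up T"
  shows "mul r (\<lambda>n. p n \<oplus> q n) = (\<lambda>n. mul r p n \<oplus> mul r q n)"
proof -
  obtain N where N: "\<forall>n>N. r n = \<zero>" using assms by (auto simp: up_iff)
  show ?thesis
    by (rule ext) (use assms N in \<open>simp add: mul_eq[where N = N] Yn_add r_distr finsum_addf Pi_def\<close>)
qed

lemma mul_scal_left:
  assumes "t \<in> carrier T" "p \<in> up T" "r \<in> up T"
  shows "mul (\<lambda>n. t \<otimes> p n) r = (\<lambda>n. t \<otimes> mul p r n)"
proof -
  obtain N where N: "\<forall>n>N. p n = \<zero>" using assms by (auto simp: up_iff)
  show ?thesis
    by (rule ext) (use assms N in \<open>simp add: mul_eq[where N = N] finsum_rdistr m_assoc Pi_def\<close>)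
qed

lemma mul_zero_left: "r \<in> up T \<Longrightarrow> mul (\<lambda>n. \<zero>) r = (\<lambda>n. \<zero>)"
  by (simp add: mul_def)

lemma mul_finsum_left:
  assumes "finite I" "\<And>i. i \<in> I \<Longrightarrow> c i \<in> carrier T" "\<And>i. i \<in> I \<Longrightarrow> f i \<in> up T" "r \<in> up T"
  shows "mul (\<lambda>n. \<Oplus>i\<in>I. c i \<otimes> f i n) r = (\<lambda>n. \<Oplus>i\<in>I. c i \<otimes> mul (f i) r n)"
  using assms
  by (induction I rule: finite_induct) (auto simp: Pi_def mul_zero_left mul_add_left mul_scal_left)

lemma mul_Y_left:
  assumes q: "q \<in> up T" and r: "r \<in> up T"
  shows "mul (Y q) r = Y (mul q r)"
proof
  fix n
  obtain N where N: "\<forall>n>N. q n = \<zero>" using q by (auto simp: up_iff)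
  hence N': "\<forall>n>Suc N. Y q n = \<zero>" by (auto simp: ore_shift_def split: nat.split)
  define a where "a i = (case i of 0 \<Rightarrow> \<zero> | Suc k \<Rightarrow> \<sigma> (q k)) \<otimes> (Y ^^ i) r n" for i
  define b where "b i = \<eta> (q i) \<otimes> (Y ^^ i) r n" for i
  have ab: "a i \<in> carrier T" "b i \<in> carrier T" for i
    using q r by (auto simp: a_def b_def split: nat.split)
  have "mul (Y q) r n = (\<Oplus>i\<in>{..Suc N}. a i \<oplus> b i)"
    unfolding mul_eq[OF Y_up[OF q] r N']
    by (rule finsum_cong') (use q r in \<open>auto simp: a_def b_def ore_shift_def l_distr split: nat.split\<close>)
  also have "\<dots> = (\<Oplus>i\<in>{..Suc N}. a i) \<oplus> (\<Oplus>i\<in>{..Suc N}. b i)"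
    using ab by (simp add: finsum_addf Pi_def del: finsum_Suc)
  also have "(\<Oplus>i\<in>{..Suc N}. a i) = (\<Oplus>i\<in>{..N}. a (Suc i))"
  proof -
    have "a 0 = \<zero>" using r by (simp add: a_def)
    thus ?thesis using finsum_Suc2[of a N] ab by (simp add: Pi_def)
  qed
  also have "(\<Oplus>i\<in>{..Suc N}. b i) = (\<Oplus>i\<in>{..N}. b i)"
  proof -
    have "b (Suc N) = \<zero>" using N r by (simp add: b_def)
    thus ?thesis using ab by (simp add: Pi_def)
  qed
  also have "(\<Oplus>i\<in>{..N}. a (Suc i)) \<oplus> (\<Oplus>i\<in>{..N}. b i)
      = (\<Oplus>i\<in>{..N}. \<sigma> (q i) \<otimes> Y ((Y ^^ i) r) n \<oplus> \<eta> (q i) \<otimes> (Y ^^ i) r n)"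
    using ab q r by (subst finsum_addf[symmetric]) (auto simp: a_def b_def Pi_def)
  also have "\<dots> = Y (\<lambda>n. \<Oplus>i\<in>{..N}. q i \<otimes> (Y ^^ i) r n) n"
    using q r by (subst Y_finsum) auto
  also have "(\<lambda>n. \<Oplus>i\<in>{..N}. q i \<otimes> (Y ^^ i) r n) = mul q r"
    using mul_eq[OF q r N] by auto
  finally show "mul (Y q) r n = Y (mul q r) n" .
qed

lemma mul_Yn_left: "q \<in> up T \<Longrightarrow> r \<in> up T \<Longrightarrow> mul ((Y ^^ i) q) r = (Y ^^ i) (mul q r)"
  by (induction i) (auto simp: mul_Y_left)

lemma mul_assoc:
  assumes "p \<in> up T" "q \<in> up T" "r \<in> up T"
  shows "mul (mul p q) r = mul p (mul q r)"
proof -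
  have "mul (mul p q) r = (\<lambda>n. \<Oplus>i\<in>{i. p i \<noteq> \<zero>}. p i \<otimes> mul ((Y ^^ i) q) r n)"
    unfolding mul_def[of p q] using assms by (intro mul_finsum_left) (auto simp: up_supp)
  also have "\<dots> = mul p (mul q r)"
    using assms by (simp add: mul_Yn_left mul_def[of p])
  finally show ?thesis .
qed

lemma monom_eq: "a \<in> carrier T \<Longrightarrow> monom (UP T) a n = (\<lambda>i. if i = n then a else \<zero>)"
  by (simp add: UP_def)

lemma monom_up [simp]: "a \<in> carrier T \<Longrightarrow> (\<lambda>i. if i = n then a else \<zero>) \<in> up T"
  by (auto simp: up_iff intro!: exI[of _ n])

lemma mul_monom_left:
  assumes "a \<in> carrier T" "q \<in> up T"
  shows "mul (\<lambda>i. if i = k then a else \<zero>) q = (\<lambda>n. a \<otimes> (Y ^^ k) q n)"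
proof (rule ext)
  fix n
  have "mul (\<lambda>i. if i = k then a else \<zero>) q n
    = (\<Oplus>i\<in>{k}. (if i = k then a else \<zero>) \<otimes> (Y ^^ i) q n)"
    unfolding mul_def by (rule add.finprod_mono_neutral_cong_left) (use assms in auto)
  thus "mul (\<lambda>i. if i = k then a else \<zero>) q n = a \<otimes> (Y ^^ k) q n" using assms by simp
qed

lemma Y_monom: "Y (\<lambda>i. if i = k then \<one> else \<zero>) = (\<lambda>i. if i = Suc k then \<one> else \<zero>)"
  by (rule ext) (auto simp: ore_shift_def split: nat.split)

lemma Yn_one: "(Y ^^ k) (\<lambda>i. if i = 0 then \<one> else \<zero>) = (\<lambda>i. if i = k then \<one> else \<zero>)"
  by (induction k) (auto simp: Y_monom)

lemma mul_one_right:
  assumes "p \<in> up T"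
  shows "mul p (\<lambda>i. if i = 0 then \<one> else \<zero>) = p"
proof (rule ext)
  fix n
  have "mul p (\<lambda>i. if i = 0 then \<one> else \<zero>) n = (\<Oplus>i\<in>{i. p i \<noteq> \<zero>}. if n = i then p i else \<zero>)"
    unfolding mul_def Yn_one by (rule finsum_cong') (use assms in auto)
  also have "\<dots> = p n"
  proof (cases "p n = \<zero>")
    case True
    thus ?thesis using assms by (subst finsum_cong'[of _ _ "\<lambda>_. \<zero>"]) auto
  next
    case False
    thus ?thesis using assms by (intro add.finprod_singleton) (auto simp: up_supp)
  qed
  finally show "mul p (\<lambda>i. if i = 0 then \<one> else \<zero>) n = p n" .
qed

lemma S_simps:
  "carrier S = up T"
  "\<one>\<^bsub>S\<^esub> = (\<lambda>i. if i = 0 then \<one> else \<zero>)"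
  "\<zero>\<^bsub>S\<^esub> = (\<lambda>i. \<zero>)"
  "p \<otimes>\<^bsub>S\<^esub> q = mul p q"
  "\<lbrakk>p \<in> up T; q \<in> up T\<rbrakk> \<Longrightarrow> p \<oplus>\<^bsub>S\<^esub> q = (\<lambda>n. p n \<oplus> q n)"
  by (simp_all add: ore_ext_def UP_def mul_def)

lemma ring_S: "ring S"
proof -
  have "abelian_group S"
  proof (rule abelian_groupI)
    fix p assume "p \<in> carrier S"
    thus "\<exists>q\<in>carrier S. q \<oplus>\<^bsub>S\<^esub> p = \<zero>\<^bsub>S\<^esub>"
      by (intro bexI[of _ "\<lambda>n. \<ominus> p n"]) (auto simp: S_simps up_a_inv_closed l_neg)
  qed (auto simp: S_simps a_ac)
  moreover have "monoid S"
    by (rule monoidI) (auto simp: S_simps mul_assoc mul_one_right mul_monom_left)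
  ultimately show ?thesis
    by (intro ring.intro ring_axioms.intro) (auto simp: S_simps mul_add_left mul_add_right)
qed

end

text \<open>
  These properties determine the multiplication on the left module \<open>T[y]\<close>.
\<close>

theorem ore_ext_ring:
  fixes T :: "('k, 't, 'm) superalg_scheme"
  assumes "ring T" "\<sigma> \<in> ring_hom T T" "sigma_derivation T \<sigma> \<eta>"
  defines "S \<equiv> ore_ext T \<sigma> \<eta>"
  shows "ring S"
    and "\<lbrakk>t \<in> carrier T; p \<in> carrier S\<rbrakk> \<Longrightarrow> const_poly T t \<otimes>\<^bsub>S\<^esub> p = t \<odot>\<^bsub>UP T\<^esub> p"
    and "t \<in> carrier T \<Longrightarrow> const_poly T t \<otimes>\<^bsub>S\<^esub> var_poly T [^]\<^bsub>S\<^esub> (n::nat) = monom (UP T) t n"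
    and "t \<in> carrier T \<Longrightarrow> var_poly T \<otimes>\<^bsub>S\<^esub> const_poly T t
           = const_poly T (\<sigma> t) \<otimes>\<^bsub>S\<^esub> var_poly T \<oplus>\<^bsub>S\<^esub> const_poly T (\<eta> t)"
proof -
  interpret ore_data T \<sigma> \<eta> using assms by (intro ore_data.intro ore_data_axioms.intro)
  interpret S: ring S unfolding S_def by (rule ring_S)
  note simps = S_simps[folded S_def]
  show "ring S" by unfold_locales
  show *: "const_poly T t \<otimes>\<^bsub>S\<^esub> p = t \<odot>\<^bsub>UP T\<^esub> p" if "t \<in> carrier T" "p \<in> carrier S" for t p
    using that by (simp add: simps const_poly_def monom_eq mul_monom_left UP_def)
  have pow: "var_poly T [^]\<^bsub>S\<^esub> n = (\<lambda>i. if i = n then \<one>\<^bsub>T\<^esub> else \<zero>\<^bsub>T\<^esub>)" for n :: nat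
  proof (induction n)
    case (Suc n)
    have "(Y ^^ n) (\<lambda>i. if i = Suc 0 then \<one>\<^bsub>T\<^esub> else \<zero>\<^bsub>T\<^esub>) = (\<lambda>i. if i = Suc n then \<one>\<^bsub>T\<^esub> else \<zero>\<^bsub>T\<^esub>)"
      by (induction n) (auto simp: Y_monom)
    thus ?case using Suc by (auto simp: simps var_poly_def monom_eq mul_monom_left intro!: ext)
  qed (simp add: simps)
  show "const_poly T t \<otimes>\<^bsub>S\<^esub> var_poly T [^]\<^bsub>S\<^esub> n = monom (UP T) t n" if "t \<in> carrier T" for t and n :: nat
    using that unfolding pow by (auto simp: simps const_poly_def monom_eq mul_monom_left intro!: ext)
  show "var_poly T \<otimes>\<^bsub>S\<^esub> const_poly T t
      = const_poly T (\<sigma> t) \<otimes>\<^bsub>S\<^esub> var_poly T \<oplus>\<^bsub>S\<^esub> const_poly T (\<eta> t)" if t: "t \<in> carrier T" for t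
  proof -
    have 1: "const_poly T (\<sigma> t) \<otimes>\<^bsub>S\<^esub> var_poly T = (\<lambda>n. if n = 1 then \<sigma> t else \<zero>\<^bsub>T\<^esub>)"
      using t by (auto simp: simps const_poly_def var_poly_def monom_eq mul_monom_left intro!: ext)
    have 2: "var_poly T \<otimes>\<^bsub>S\<^esub> const_poly T t = Y (\<lambda>i. if i = 0 then t else \<zero>\<^bsub>T\<^esub>)"
      using t Y_up[OF monom_up[OF t, of 0]]
      by (auto simp: simps const_poly_def var_poly_def monom_eq mul_monom_left intro!: ext)
    show ?thesis
      unfolding 1 2 using t
      by (auto simp: simps const_poly_def monom_eq ore_shift_def intro!: ext split: nat.split)
  qed
qed


end

theory Submission
  imports Defs
begin

text \<open>
  The homomorphism \<open>\<phi>\<close> is surjective because its image is a subring that contains ring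
  generators of the iterated Ore extension: the constants \<open>m\<^sub>r\<close>, \<open>h\<^sub>r\<close> and the two variables
  (\<open>UEA_induct\<close>, \<open>ore_ext_induct\<close>).

  For injectivity a left inverse \<open>\<psi>\<close> is constructed.  The point is that the commutation rules of
  the iterated Ore extension already hold in \<open>U(R')\<close>.  As \<open>x\<close> is even, property P for \<open>R'\<close> says
  without signs how \<open>m\<^sub>x\<close> and \<open>h\<^sub>x\<close> commute with \<open>m\<^sub>r\<close> and \<open>h\<^sub>r\<close> (\<open>property_P_even\<close>), and
  \<open>{x,r} = \<alpha>(r) x + \<delta>(r)\<close> turns the result into \<open>y t = \<sigma>(t) y + \<eta>(t)\<close> on generators \<open>t\<close>
  (\<open>x_relations\<close>).  The remaining rule \<open>h\<^sub>x m\<^sub>x = m\<^sub>x h\<^sub>x\<close> amounts to \<open>m({x,x}) = 0\<close>, which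
  follows from \<open>2{x,x} = 0\<close>.  Since the rules are inherited by sums and products
  (\<open>skew_relation_closed\<close>), they hold for all coefficients \<open>t\<close>.  The universal property of
  \<open>U(R)\<close> gives a homomorphism \<open>U(R) \<rightarrow> U(R')\<close>, and the universal property of Ore extensions
  (\<open>ore_eval_hom\<close>) extends it first to \<open>U(R)[m\<^sub>x; \<sigma>\<^sub>1, \<eta>\<^sub>1]\<close> and then to the whole.

  The composite \<open>\<psi> \<phi>\<close> fixes \<open>m\<^sub>r, h\<^sub>r, m\<^sub>x, h\<^sub>x\<close>, and these generate \<open>U(R')\<close>
  (\<open>generator_induct\<close>), so it is the identity.
\<close>

section \<open>Generators of enveloping algebras and of Ore extensions\<close>

lemma (in UP_ring) poly_monom_induct [consumes 1, case_names monom add]: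
  assumes p: "p \<in> carrier P"
    and monom: "\<And>a n. a \<in> carrier R \<Longrightarrow> Q (monom P a n)"
    and add: "\<And>p q. \<lbrakk>p \<in> carrier P; q \<in> carrier P; Q p; Q q\<rbrakk> \<Longrightarrow> Q (p \<oplus>\<^bsub>P\<^esub> q)"
  shows "Q p"
proof -
  have "Q (\<Oplus>\<^bsub>P\<^esub> i \<in> {..n}. monom P (coeff P p i) i)" for n
    by (induction n) (use p in \<open>auto intro!: monom add\<close>)
  thus ?thesis using up_repr[OF p] by metis
qed

text \<open>
  Every element is a sum of monomials \<open>t y\<^sup>n\<close>, and these are products in the Ore extension.
\<close>

lemma (in ore_data) ore_ext_induct [consumes 1, case_names const var add mult]:
  assumes p: "p \<in> carrier S"
    and const: "\<And>t. t \<in> carrier T \<Longrightarrow> Q (const_poly T t)"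
    and var: "Q (var_poly T)"
    and add: "\<And>p q. \<lbrakk>p \<in> carrier S; q \<in> carrier S; Q p; Q q\<rbrakk> \<Longrightarrow> Q (p \<oplus>\<^bsub>S\<^esub> q)"
    and mult: "\<And>p q. \<lbrakk>p \<in> carrier S; q \<in> carrier S; Q p; Q q\<rbrakk> \<Longrightarrow> Q (p \<otimes>\<^bsub>S\<^esub> q)"
  shows "Q p"
proof -
  interpret UP: UP_ring T "UP T" by (intro UP_ring.intro ring_axioms)
  interpret S: ring S by (rule ring_S)
  have up: "carrier S = carrier (UP T)" "add S = add (UP T)"
    by (simp_all add: ore_ext_def)
  have c: "const_poly T t \<in> carrier S" if "t \<in> carrier T" for t
    using that by (simp add: up const_poly_def)
  have v: "var_poly T \<in> carrier S" by (simp add: up var_poly_def)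
  have "Q (const_poly T t \<otimes>\<^bsub>S\<^esub> var_poly T [^]\<^bsub>S\<^esub> (n::nat))" if "t \<in> carrier T" for t n
  proof (induction n)
    case 0
    thus ?case using that by (simp add: c const)
  next
    case (Suc n)
    have "const_poly T t \<otimes>\<^bsub>S\<^esub> var_poly T [^]\<^bsub>S\<^esub> Suc n
      = (const_poly T t \<otimes>\<^bsub>S\<^esub> var_poly T [^]\<^bsub>S\<^esub> n) \<otimes>\<^bsub>S\<^esub> var_poly T"
      using c[OF that] v by (simp add: S.m_assoc)
    thus ?case using Suc c[OF that] v by (simp only: mult var S.m_closed S.nat_pow_closed)
  qed
  hence "Q (monom (UP T) t n)" if "t \<in> carrier T" for t n
    using that ore_ext_ring(3)[OF ring_axioms sigma eta] by metis
  thus ?thesis using UP.poly_monom_induct[OF p[unfolded up(1)], of Q] add[unfolded up] by blast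
qed

text \<open>
  A scalar multiple is a product with a generator, \<open>c \<odot> u = m(c \<odot> 1) u\<close>, so \<open>U(R)\<close> is generated
  by the \<open>m\<^sub>r\<close> and \<open>h\<^sub>r\<close> even as a ring.  This makes the principle applicable to relations that involve a
  \<open>\<sigma>\<close>-derivation, a map that is additive but not \<open>K\<close>-linear by definition.
\<close>

lemma (in poisson_superalgebra) UEA_induct [consumes 1, case_names m h add mult]:
  assumes u: "u \<in> carrier (UEA K R)"
    and m: "\<And>r. r \<in> carrier R \<Longrightarrow> Q (uea_m K R r)"
    and h: "\<And>r. r \<in> carrier R \<Longrightarrow> Q (uea_h K R r)"
    and add: "\<And>u v. \<lbrakk>u \<in> carrier (UEA K R); v \<in> carrier (UEA K R); Q u; Q v\<rbrakk>
      \<Longrightarrow> Q (u \<oplus>\<^bsub>UEA K R\<^esub> v)"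
    and mult: "\<And>u v. \<lbrakk>u \<in> carrier (UEA K R); v \<in> carrier (UEA K R); Q u; Q v\<rbrakk>
      \<Longrightarrow> Q (u \<otimes>\<^bsub>UEA K R\<^esub> v)"
  shows "Q u"
proof -
  let ?U = "UEA K R"
  interpret U: assoc_algebra K ?U by (rule UEA_assoc_algebra)
  have alg: "uea_m K R \<in> algebra_hom K R ?U"
    using UEA_pre by (simp add: pre_property_P_def)
  have one: "uea_m K R \<one>\<^bsub>R\<^esub> = \<one>\<^bsub>?U\<^esub>"
    and smult: "\<And>c x. \<lbrakk>c \<in> carrier K; x \<in> carrier R\<rbrakk> \<Longrightarrow> uea_m K R (c \<odot>\<^bsub>R\<^esub> x) = c \<odot>\<^bsub>?U\<^esub> uea_m K R x"
    using alg by (auto simp: algebra_hom_def ring_hom_def linear_maps_def)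
  have scalar: "Q (c \<odot>\<^bsub>?U\<^esub> \<one>\<^bsub>?U\<^esub>)" if "c \<in> carrier K" for c
    using m[of "c \<odot>\<^bsub>R\<^esub> \<one>\<^bsub>R\<^esub>"] that by (simp add: smult one)
  have "Q (uea_class K R t)" if "t \<in> uea_terms K R" for t
    using that
  proof (induction t)
    case Zero
    show ?case using scalar[of "\<zero>\<^bsub>K\<^esub>"] by (simp flip: UEA_simps(3))
  next
    case One
    show ?case using m[of "\<one>\<^bsub>R\<^esub>"] by (simp add: one flip: UEA_simps(2))
  next
    case (Scal c s)
    hence s: "uea_class K R s \<in> carrier ?U" "c \<in> carrier K" by (simp_all add: UEA_simps)
    have "uea_class K R (Scal c s) = (c \<odot>\<^bsub>?U\<^esub> \<one>\<^bsub>?U\<^esub>) \<otimes>\<^bsub>?U\<^esub> uea_class K R s"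
      using Scal s by (simp add: U.smult_mult_left flip: UEA_simps(7))
    thus ?case using Scal s by (simp only: mult scalar U.smult_closed U.one_closed uea_terms_simps)
  qed (use m h add mult in \<open>auto simp: uea_m_def uea_h_def UEA_simps(1) simp flip: UEA_simps(5,6)\<close>)
  thus ?thesis using u by (auto simp: UEA_simps(1))
qed

lemma (in ore_data) const_var_closed [simp]:
  "t \<in> carrier T \<Longrightarrow> const_poly T t \<in> carrier S" "var_poly T \<in> carrier S"
  by (simp_all add: S_simps const_poly_def var_poly_def monom_eq)

lemma (in ore_data) const_poly_hom: "const_poly T \<in> ring_hom T S"
  by (rule ring_hom_memI)
    (auto simp: S_simps const_poly_def monom_eq mul_monom_left intro!: ext)

lemma (in poisson_superalgebra) ore_ext_UEA_induct [consumes 2, case_names m h var add mult]: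
  assumes "ore_data (UEA K R) \<sigma> \<eta>"
  defines "T \<equiv> ore_ext (UEA K R) \<sigma> \<eta>"
  assumes p: "p \<in> carrier T"
    and m: "\<And>r. r \<in> carrier R \<Longrightarrow> Q (const_poly (UEA K R) (uea_m K R r))"
    and h: "\<And>r. r \<in> carrier R \<Longrightarrow> Q (const_poly (UEA K R) (uea_h K R r))"
    and var: "Q (var_poly (UEA K R))"
    and add: "\<And>p q. \<lbrakk>p \<in> carrier T; q \<in> carrier T; Q p; Q q\<rbrakk> \<Longrightarrow> Q (p \<oplus>\<^bsub>T\<^esub> q)"
    and mult: "\<And>p q. \<lbrakk>p \<in> carrier T; q \<in> carrier T; Q p; Q q\<rbrakk> \<Longrightarrow> Q (p \<otimes>\<^bsub>T\<^esub> q)"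
  shows "Q p"
proof -
  interpret E: ore_data "UEA K R" \<sigma> \<eta> by fact
  note c = ring_hom_add[OF E.const_poly_hom, folded T_def] ring_hom_mult[OF E.const_poly_hom, folded T_def]
    E.const_var_closed[folded T_def]
  have "Q (const_poly (UEA K R) u)" if "u \<in> carrier (UEA K R)" for u
    using that by (induction rule: UEA_induct) (simp_all add: m h c add mult)
  thus ?thesis
    using E.ore_ext_induct[of p Q, folded T_def, OF p _ var add mult] by blast
qed

section \<open>The universal property of an Ore extension\<close>

text \<open>
  The twisted Leibniz rule of \<open>\<eta>\<close> is what makes the relation \<open>y f(t) = f(\<sigma> t) y + f(\<eta> t)\<close>
  survive products: \<open>y\<close> is moved past \<open>f(s)\<close> and then past \<open>f(t)\<close>.  Therefore the relation
  has to be verified on ring generators of \<open>T\<close> only.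
\<close>

lemma skew_relation_closed:
  assumes "ring T" "ring B" "f \<in> ring_hom T B" "\<sigma> \<in> ring_hom T T" "sigma_derivation T \<sigma> \<eta>"
    and y: "y \<in> carrier B"
    and st: "s \<in> carrier T" "t \<in> carrier T"
    and s: "y \<otimes>\<^bsub>B\<^esub> f s = f (\<sigma> s) \<otimes>\<^bsub>B\<^esub> y \<oplus>\<^bsub>B\<^esub> f (\<eta> s)"
    and t: "y \<otimes>\<^bsub>B\<^esub> f t = f (\<sigma> t) \<otimes>\<^bsub>B\<^esub> y \<oplus>\<^bsub>B\<^esub> f (\<eta> t)"
  shows "y \<otimes>\<^bsub>B\<^esub> f (s \<oplus>\<^bsub>T\<^esub> t) = f (\<sigma> (s \<oplus>\<^bsub>T\<^esub> t)) \<otimes>\<^bsub>B\<^esub> y \<oplus>\<^bsub>B\<^esub> f (\<eta> (s \<oplus>\<^bsub>T\<^esub> t))"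
    and "y \<otimes>\<^bsub>B\<^esub> f (s \<otimes>\<^bsub>T\<^esub> t) = f (\<sigma> (s \<otimes>\<^bsub>T\<^esub> t)) \<otimes>\<^bsub>B\<^esub> y \<oplus>\<^bsub>B\<^esub> f (\<eta> (s \<otimes>\<^bsub>T\<^esub> t))"
proof -
  interpret T: ring T by fact
  interpret B: ring B by fact
  note f = ring_hom_closed[OF assms(3)] ring_hom_mult[OF assms(3)] ring_hom_add[OF assms(3)]
  note sig = ring_hom_closed[OF assms(4)] ring_hom_mult[OF assms(4)] ring_hom_add[OF assms(4)]
  have eta: "\<And>x. x \<in> carrier T \<Longrightarrow> \<eta> x \<in> carrier T"
    "\<eta> (s \<oplus>\<^bsub>T\<^esub> t) = \<eta> s \<oplus>\<^bsub>T\<^esub> \<eta> t" "\<eta> (s \<otimes>\<^bsub>T\<^esub> t) = \<sigma> s \<otimes>\<^bsub>T\<^esub> \<eta> t \<oplus>\<^bsub>T\<^esub> \<eta> s \<otimes>\<^bsub>T\<^esub> t"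
    using assms(5) st by (auto simp: sigma_derivation_def)
  note simps = f sig eta st y B.l_distr B.r_distr B.a_ac
  show "y \<otimes>\<^bsub>B\<^esub> f (s \<oplus>\<^bsub>T\<^esub> t) = f (\<sigma> (s \<oplus>\<^bsub>T\<^esub> t)) \<otimes>\<^bsub>B\<^esub> y \<oplus>\<^bsub>B\<^esub> f (\<eta> (s \<oplus>\<^bsub>T\<^esub> t))"
    by (simp add: simps s t)
  have "y \<otimes>\<^bsub>B\<^esub> f (s \<otimes>\<^bsub>T\<^esub> t) = (y \<otimes>\<^bsub>B\<^esub> f s) \<otimes>\<^bsub>B\<^esub> f t"
    by (simp add: simps B.m_assoc)
  also have "\<dots> = f (\<sigma> s) \<otimes>\<^bsub>B\<^esub> (y \<otimes>\<^bsub>B\<^esub> f t) \<oplus>\<^bsub>B\<^esub> f (\<eta> s) \<otimes>\<^bsub>B\<^esub> f t"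
    unfolding s by (simp add: simps B.m_assoc)
  also have "\<dots> = f (\<sigma> (s \<otimes>\<^bsub>T\<^esub> t)) \<otimes>\<^bsub>B\<^esub> y \<oplus>\<^bsub>B\<^esub> f (\<eta> (s \<otimes>\<^bsub>T\<^esub> t))"
    unfolding t by (simp add: simps B.m_assoc)
  finally show "y \<otimes>\<^bsub>B\<^esub> f (s \<otimes>\<^bsub>T\<^esub> t) = f (\<sigma> (s \<otimes>\<^bsub>T\<^esub> t)) \<otimes>\<^bsub>B\<^esub> y \<oplus>\<^bsub>B\<^esub> f (\<eta> (s \<otimes>\<^bsub>T\<^esub> t))" .
qed

text \<open>
  The data that define a ring homomorphism from \<open>T[y; \<sigma>, \<eta>]\<close> to \<open>B\<close>: a homomorphism \<open>f\<close> on
  the coefficients and an image of the variable that satisfies the commutation rule.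
\<close>

locale ore_target = ore_data T \<sigma> \<eta> + B: ring B
  for T :: "('k, 't, 'm) superalg_scheme" (structure) and \<sigma> \<eta> and B :: "('b, 'n) ring_scheme" +
  fixes f :: "'t \<Rightarrow> 'b" and y :: 'b
  assumes f_hom: "f \<in> ring_hom T B" and y_closed [simp]: "y \<in> carrier B"
    and skew: "t \<in> carrier T \<Longrightarrow> y \<otimes>\<^bsub>B\<^esub> f t = f (\<sigma> t) \<otimes>\<^bsub>B\<^esub> y \<oplus>\<^bsub>B\<^esub> f (\<eta> t)"
begin

lemma f_simps [simp]:
  "t \<in> carrier T \<Longrightarrow> f t \<in> carrier B"
  "\<lbrakk>s \<in> carrier T; t \<in> carrier T\<rbrakk> \<Longrightarrow> f (s \<oplus> t) = f s \<oplus>\<^bsub>B\<^esub> f t"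
  "\<lbrakk>s \<in> carrier T; t \<in> carrier T\<rbrakk> \<Longrightarrow> f (s \<otimes> t) = f s \<otimes>\<^bsub>B\<^esub> f t"
  "f \<one> = \<one>\<^bsub>B\<^esub>" "f \<zero> = \<zero>\<^bsub>B\<^esub>"
  using f_hom ring_hom_zero[OF f_hom ring_axioms B.ring_axioms] by (auto simp: ring_hom_def)

definition ore_eval :: "(nat \<Rightarrow> 't) \<Rightarrow> 'b" where
  "ore_eval p = (\<Oplus>\<^bsub>B\<^esub>i\<in>{i. p i \<noteq> \<zero>}. f (p i) \<otimes>\<^bsub>B\<^esub> y [^]\<^bsub>B\<^esub> i)"

lemma ore_eval_eq:
  assumes "p \<in> up T" "\<forall>n>N. p n = \<zero>"
  shows "ore_eval p = (\<Oplus>\<^bsub>B\<^esub>i\<in>{..N}. f (p i) \<otimes>\<^bsub>B\<^esub> y [^]\<^bsub>B\<^esub> i)"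
  unfolding ore_eval_def
  by (rule B.add.finprod_mono_neutral_cong_left) (use assms in \<open>auto simp: not_less[symmetric]\<close>)

lemma ore_eval_closed [simp]: "p \<in> up T \<Longrightarrow> ore_eval p \<in> carrier B"
  unfolding ore_eval_def by (rule B.finsum_closed) auto

lemma ore_eval_add:
  assumes "p \<in> up T" "q \<in> up T"
  shows "ore_eval (\<lambda>n. p n \<oplus> q n) = ore_eval p \<oplus>\<^bsub>B\<^esub> ore_eval q"
proof -
  obtain N where N: "\<forall>n>N. p n = \<zero>" "\<forall>n>N. q n = \<zero>" using assms common_bound by blast
  show ?thesis
    using assms N by (simp add: ore_eval_eq[where N = N] B.l_distr B.finsum_addf Pi_def)
qed

lemma ore_eval_scal:
  assumes "t \<in> carrier T" "p \<in> up T"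
  shows "ore_eval (\<lambda>n. t \<otimes> p n) = f t \<otimes>\<^bsub>B\<^esub> ore_eval p"
proof -
  obtain N where N: "\<forall>n>N. p n = \<zero>" using assms by (auto simp: up_iff)
  show ?thesis
    using assms N by (simp add: ore_eval_eq[where N = N] B.finsum_rdistr B.m_assoc Pi_def)
qed

lemma ore_eval_monom:
  assumes "t \<in> carrier T"
  shows "ore_eval (\<lambda>i. if i = n then t else \<zero>) = f t \<otimes>\<^bsub>B\<^esub> y [^]\<^bsub>B\<^esub> n"
proof -
  have "ore_eval (\<lambda>i. if i = n then t else \<zero>)
    = (\<Oplus>\<^bsub>B\<^esub>i\<in>{n}. f (if i = n then t else \<zero>) \<otimes>\<^bsub>B\<^esub> y [^]\<^bsub>B\<^esub> i)"
    unfolding ore_eval_def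
    by (rule B.add.finprod_mono_neutral_cong_left) (use assms in auto)
  thus ?thesis using assms by simp
qed

lemma Y_scaled_monom: "t \<in> carrier T \<Longrightarrow> Y (\<lambda>i. if i = n then t else \<zero>)
  = (\<lambda>i. (if i = Suc n then \<sigma> t else \<zero>) \<oplus> (if i = n then \<eta> t else \<zero>))"
  by (rule ext) (auto simp: ore_shift_def split: nat.split)

lemma y_pow_comm: "y \<otimes>\<^bsub>B\<^esub> y [^]\<^bsub>B\<^esub> n = y [^]\<^bsub>B\<^esub> n \<otimes>\<^bsub>B\<^esub> y" for n :: nat
  using B.nat_pow_Suc2[of y n] by simp

text \<open>
  The map \<open>Y\<close> is left multiplication by the variable, so this is multiplicativity for a left
  factor \<open>y\<close>.  It is the only place where the commutation rule in \<open>B\<close> enters.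
\<close>

lemma ore_eval_Y:
  assumes "p \<in> up T"
  shows "ore_eval (Y p) = y \<otimes>\<^bsub>B\<^esub> ore_eval p"
proof -
  interpret UP: UP_ring T "UP T" by (intro UP_ring.intro ring_axioms)
  have p: "p \<in> carrier (UP T)" using assms by (simp add: UP_def)
  show ?thesis using p
  proof (induction rule: UP.poly_monom_induct)
    case (monom t n)
    have "ore_eval (Y (\<lambda>i. if i = n then t else \<zero>))
        = f (\<sigma> t) \<otimes>\<^bsub>B\<^esub> (y \<otimes>\<^bsub>B\<^esub> y [^]\<^bsub>B\<^esub> n) \<oplus>\<^bsub>B\<^esub> f (\<eta> t) \<otimes>\<^bsub>B\<^esub> y [^]\<^bsub>B\<^esub> n"
      using monom by (simp add: Y_scaled_monom ore_eval_add ore_eval_monom y_pow_comm)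
    also have "\<dots> = (y \<otimes>\<^bsub>B\<^esub> f t) \<otimes>\<^bsub>B\<^esub> y [^]\<^bsub>B\<^esub> n"
      using monom by (simp add: skew B.l_distr B.m_assoc)
    finally show ?case using monom by (simp add: monom_eq ore_eval_monom B.m_assoc)
  next
    case (add p q)
    thus ?case by (simp add: UP_def Y_add ore_eval_add B.r_distr)
  qed
qed

lemma ore_eval_Yn: "p \<in> up T \<Longrightarrow> ore_eval ((Y ^^ i) p) = y [^]\<^bsub>B\<^esub> i \<otimes>\<^bsub>B\<^esub> ore_eval p"
  by (induction i) (auto simp: ore_eval_Y y_pow_comm simp flip: B.m_assoc)

lemma ore_eval_mul:
  assumes "p \<in> up T" "q \<in> up T"
  shows "ore_eval (mul p q) = ore_eval p \<otimes>\<^bsub>B\<^esub> ore_eval q"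
proof -
  interpret UP: UP_ring T "UP T" by (intro UP_ring.intro ring_axioms)
  have p: "p \<in> carrier (UP T)" using assms by (simp add: UP_def)
  show ?thesis using p
  proof (induction rule: UP.poly_monom_induct)
    case (monom t n)
    thus ?case using assms by (simp add: monom_eq mul_monom_left ore_eval_scal ore_eval_Yn ore_eval_monom B.m_assoc)
  next
    case (add p q')
    thus ?case using assms by (simp add: UP_def mul_add_left ore_eval_add B.l_distr)
  qed
qed

theorem ore_eval_hom: "ore_eval \<in> ring_hom S B"
  by (rule ring_hom_memI)
    (simp_all add: S_simps ore_eval_mul ore_eval_add ore_eval_monom)

lemma ore_eval_const: "t \<in> carrier T \<Longrightarrow> ore_eval (const_poly T t) = f t"
  by (simp add: const_poly_def monom_eq ore_eval_monom)

lemma ore_eval_var: "ore_eval (var_poly T) = y"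
  by (simp add: var_poly_def monom_eq ore_eval_monom[of _ "Suc 0"])

end

section \<open>Even elements of a Poisson superalgebra\<close>

context poisson_superalgebra
begin

lemma even_bracket_skew:
  assumes x: "x \<in> grade R 0" and r: "r \<in> grade R q"
  shows "pbracket R r x = \<ominus>\<^bsub>R\<^esub> pbracket R x r"
proof -
  have "pbracket R x r \<in> carrier R" using bracket_closed grade_closed x r by blast
  thus ?thesis using bracket_skew[OF r x] by (simp add: ksgn_def)
qed

text \<open>
  All signs are \<open>+1\<close> as soon as one of the two elements is even, so that graded commutators
  become commutators.  The third relation is the second one with the roles of \<open>x\<close> and \<open>r\<close>
  exchanged, rewritten by means of \<open>{r,x} = -{x,r}\<close>.
\<close>

lemma property_P_homogeneous_even:
  assumes P: "pre_property_P K R B \<gamma> \<delta>" and x: "x \<in> grade R 0" and r: "r \<in> grade R q"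
  shows "\<delta> x \<otimes>\<^bsub>B\<^esub> \<delta> r = \<delta> r \<otimes>\<^bsub>B\<^esub> \<delta> x \<oplus>\<^bsub>B\<^esub> \<delta> (pbracket R x r)"
    and "\<delta> x \<otimes>\<^bsub>B\<^esub> \<gamma> r = \<gamma> r \<otimes>\<^bsub>B\<^esub> \<delta> x \<oplus>\<^bsub>B\<^esub> \<gamma> (pbracket R x r)"
    and "\<gamma> x \<otimes>\<^bsub>B\<^esub> \<delta> r = \<delta> r \<otimes>\<^bsub>B\<^esub> \<gamma> x \<oplus>\<^bsub>B\<^esub> \<gamma> (pbracket R x r)"
    and "\<delta> (r \<otimes>\<^bsub>R\<^esub> x) = \<gamma> r \<otimes>\<^bsub>B\<^esub> \<delta> x \<oplus>\<^bsub>B\<^esub> \<gamma> x \<otimes>\<^bsub>B\<^esub> \<delta> r"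
    and "\<gamma> x \<otimes>\<^bsub>B\<^esub> \<gamma> r = \<gamma> r \<otimes>\<^bsub>B\<^esub> \<gamma> x"
proof -
  interpret B: assoc_algebra K B using P by (simp add: pre_property_P_def)
  have c: "x \<in> carrier R" "r \<in> carrier R" "pbracket R x r \<in> carrier R"
    using x r grade_closed bracket_closed by auto
  have lin: "\<And>z. z \<in> carrier R \<Longrightarrow> \<gamma> z \<in> carrier B" "\<And>z. z \<in> carrier R \<Longrightarrow> \<delta> z \<in> carrier B"
    "\<And>z w. \<lbrakk>z \<in> carrier R; w \<in> carrier R\<rbrakk> \<Longrightarrow> \<gamma> (z \<otimes>\<^bsub>R\<^esub> w) = \<gamma> z \<otimes>\<^bsub>B\<^esub> \<gamma> w"
    "\<And>c z. \<lbrakk>c \<in> carrier K; z \<in> carrier R\<rbrakk> \<Longrightarrow> \<gamma> (c \<odot>\<^bsub>R\<^esub> z) = c \<odot>\<^bsub>B\<^esub> \<gamma> z"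
    using P by (auto simp: pre_property_P_def algebra_hom_def linear_maps_def ring_hom_def)
  have neg: "\<gamma> (\<ominus>\<^bsub>R\<^esub> z) = \<ominus>\<^bsub>B\<^esub> \<gamma> z" if "z \<in> carrier R" for z
    using lin(4)[of "\<ominus>\<^bsub>K\<^esub> \<one>\<^bsub>K\<^esub>" z] that lin by (simp add: smult_l_minus B.smult_l_minus)
  have rel: "\<And>p q x y. \<lbrakk>x \<in> grade R p; y \<in> grade R q\<rbrakk> \<Longrightarrow>
        \<delta> (pbracket R x y) = gr_commutator K B p q (\<delta> x) (\<delta> y) \<and>
        \<gamma> (pbracket R x y) = gr_commutator K B p q (\<delta> x) (\<gamma> y) \<and>
        \<delta> (x \<otimes>\<^bsub>R\<^esub> y) = \<gamma> x \<otimes>\<^bsub>B\<^esub> \<delta> y \<oplus>\<^bsub>B\<^esub> ksgn K (p * q) \<odot>\<^bsub>B\<^esub> (\<gamma> y \<otimes>\<^bsub>B\<^esub> \<delta> x)"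
    using P by (auto simp: pre_property_P_def)
  have c': "\<gamma> x \<in> carrier B" "\<gamma> r \<in> carrier B" "\<delta> x \<in> carrier B" "\<delta> r \<in> carrier B"
    using c lin by auto
  note xr = rel[OF x r, unfolded gr_commutator_def] and rx = rel[OF r x, unfolded gr_commutator_def]
  have move: "a = b \<oplus>\<^bsub>B\<^esub> (a \<ominus>\<^bsub>B\<^esub> b)" if "a \<in> carrier B" "b \<in> carrier B" for a b
    using that by (simp add: a_minus_def B.M.a_ac B.M.r_neg1 B.M.r_neg2 B.M.r_neg)
  show "\<delta> x \<otimes>\<^bsub>B\<^esub> \<delta> r = \<delta> r \<otimes>\<^bsub>B\<^esub> \<delta> x \<oplus>\<^bsub>B\<^esub> \<delta> (pbracket R x r)"
    "\<delta> x \<otimes>\<^bsub>B\<^esub> \<gamma> r = \<gamma> r \<otimes>\<^bsub>B\<^esub> \<delta> x \<oplus>\<^bsub>B\<^esub> \<gamma> (pbracket R x r)"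
    using xr c' by (simp_all add: ksgn_def flip: move)
  show "\<delta> (r \<otimes>\<^bsub>R\<^esub> x) = \<gamma> r \<otimes>\<^bsub>B\<^esub> \<delta> x \<oplus>\<^bsub>B\<^esub> \<gamma> x \<otimes>\<^bsub>B\<^esub> \<delta> r"
    using rx c' by (simp add: ksgn_def)
  show "\<gamma> x \<otimes>\<^bsub>B\<^esub> \<gamma> r = \<gamma> r \<otimes>\<^bsub>B\<^esub> \<gamma> x"
    using supercommutative[OF x r] c lin(3) by (simp add: ksgn_def flip: lin(3))
  have "\<ominus>\<^bsub>B\<^esub> \<gamma> (pbracket R x r) = \<delta> r \<otimes>\<^bsub>B\<^esub> \<gamma> x \<ominus>\<^bsub>B\<^esub> \<gamma> x \<otimes>\<^bsub>B\<^esub> \<delta> r"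
    using rx c' c neg by (simp add: ksgn_def even_bracket_skew[OF x r])
  hence "\<ominus>\<^bsub>B\<^esub> (\<ominus>\<^bsub>B\<^esub> \<gamma> (pbracket R x r)) = \<gamma> x \<otimes>\<^bsub>B\<^esub> \<delta> r \<ominus>\<^bsub>B\<^esub> \<delta> r \<otimes>\<^bsub>B\<^esub> \<gamma> x"
    using c' by (simp add: a_minus_def B.M.minus_add B.M.a_ac)
  thus "\<gamma> x \<otimes>\<^bsub>B\<^esub> \<delta> r = \<delta> r \<otimes>\<^bsub>B\<^esub> \<gamma> x \<oplus>\<^bsub>B\<^esub> \<gamma> (pbracket R x r)"
    using c c' lin by (simp flip: move)
qed

text \<open>
  In the homogeneous case the relations do not depend on the parity of \<open>r\<close>, and they are
  additive in \<open>r\<close>; so they hold for all \<open>r\<close>.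
\<close>

lemma property_P_even:
  assumes P: "pre_property_P K R B \<gamma> \<delta>" and x: "x \<in> grade R 0" and r: "r \<in> carrier R"
  shows "\<delta> x \<otimes>\<^bsub>B\<^esub> \<delta> r = \<delta> r \<otimes>\<^bsub>B\<^esub> \<delta> x \<oplus>\<^bsub>B\<^esub> \<delta> (pbracket R x r)"
    and "\<delta> x \<otimes>\<^bsub>B\<^esub> \<gamma> r = \<gamma> r \<otimes>\<^bsub>B\<^esub> \<delta> x \<oplus>\<^bsub>B\<^esub> \<gamma> (pbracket R x r)"
    and "\<gamma> x \<otimes>\<^bsub>B\<^esub> \<delta> r = \<delta> r \<otimes>\<^bsub>B\<^esub> \<gamma> x \<oplus>\<^bsub>B\<^esub> \<gamma> (pbracket R x r)"
    and "\<delta> (r \<otimes>\<^bsub>R\<^esub> x) = \<gamma> r \<otimes>\<^bsub>B\<^esub> \<delta> x \<oplus>\<^bsub>B\<^esub> \<gamma> x \<otimes>\<^bsub>B\<^esub> \<delta> r"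
    and "\<gamma> x \<otimes>\<^bsub>B\<^esub> \<gamma> r = \<gamma> r \<otimes>\<^bsub>B\<^esub> \<gamma> x"
proof -
  interpret B: assoc_algebra K B using P by (simp add: pre_property_P_def)
  obtain a b where ab: "a \<in> grade R 0" "b \<in> grade R 1" "r = a \<oplus>\<^bsub>R\<^esub> b"
    using grade_sum[OF r] by blast
  have c: "x \<in> carrier R" "a \<in> carrier R" "b \<in> carrier R"
    using x ab grade_closed by auto
  have lin: "\<And>z. z \<in> carrier R \<Longrightarrow> \<gamma> z \<in> carrier B" "\<And>z. z \<in> carrier R \<Longrightarrow> \<delta> z \<in> carrier B"
    "\<And>z w. \<lbrakk>z \<in> carrier R; w \<in> carrier R\<rbrakk> \<Longrightarrow> \<gamma> (z \<oplus>\<^bsub>R\<^esub> w) = \<gamma> z \<oplus>\<^bsub>B\<^esub> \<gamma> w"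
    "\<And>z w. \<lbrakk>z \<in> carrier R; w \<in> carrier R\<rbrakk> \<Longrightarrow> \<delta> (z \<oplus>\<^bsub>R\<^esub> w) = \<delta> z \<oplus>\<^bsub>B\<^esub> \<delta> w"
    using P by (auto simp: pre_property_P_def algebra_hom_def linear_maps_def)
  note simps = ab(3) lin c bracket_closed bracket_add_right A.l_distr B.A.l_distr B.A.r_distr B.M.a_ac
  show "\<delta> x \<otimes>\<^bsub>B\<^esub> \<delta> r = \<delta> r \<otimes>\<^bsub>B\<^esub> \<delta> x \<oplus>\<^bsub>B\<^esub> \<delta> (pbracket R x r)"
    using property_P_homogeneous_even(1)[OF P x ab(1)] property_P_homogeneous_even(1)[OF P x ab(2)]
    by (simp add: simps)
  show "\<delta> x \<otimes>\<^bsub>B\<^esub> \<gamma> r = \<gamma> r \<otimes>\<^bsub>B\<^esub> \<delta> x \<oplus>\<^bsub>B\<^esub> \<gamma> (pbracket R x r)"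
    using property_P_homogeneous_even(2)[OF P x ab(1)] property_P_homogeneous_even(2)[OF P x ab(2)]
    by (simp add: simps)
  show "\<gamma> x \<otimes>\<^bsub>B\<^esub> \<delta> r = \<delta> r \<otimes>\<^bsub>B\<^esub> \<gamma> x \<oplus>\<^bsub>B\<^esub> \<gamma> (pbracket R x r)"
    using property_P_homogeneous_even(3)[OF P x ab(1)] property_P_homogeneous_even(3)[OF P x ab(2)]
    by (simp add: simps)
  show "\<delta> (r \<otimes>\<^bsub>R\<^esub> x) = \<gamma> r \<otimes>\<^bsub>B\<^esub> \<delta> x \<oplus>\<^bsub>B\<^esub> \<gamma> x \<otimes>\<^bsub>B\<^esub> \<delta> r"
    using property_P_homogeneous_even(4)[OF P x ab(1)] property_P_homogeneous_even(4)[OF P x ab(2)]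
    by (simp add: simps)
  show "\<gamma> x \<otimes>\<^bsub>B\<^esub> \<gamma> r = \<gamma> r \<otimes>\<^bsub>B\<^esub> \<gamma> x"
    using property_P_homogeneous_even(5)[OF P x ab(1)] property_P_homogeneous_even(5)[OF P x ab(2)]
    by (simp add: simps)
qed

lemma even_bracket_self:
  assumes x: "x \<in> grade R 0"
    and two: "\<And>z. \<lbrakk>z \<in> carrier R; z \<oplus>\<^bsub>R\<^esub> z = \<zero>\<^bsub>R\<^esub>\<rbrakk> \<Longrightarrow> z = \<zero>\<^bsub>R\<^esub>"
  shows "pbracket R x x = \<zero>\<^bsub>R\<^esub>"
proof (rule two)
  have c: "pbracket R x x \<in> carrier R" using bracket_closed grade_closed x by blast
  thus "pbracket R x x \<in> carrier R" .
  show "pbracket R x x \<oplus>\<^bsub>R\<^esub> pbracket R x x = \<zero>\<^bsub>R\<^esub>"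
    using even_bracket_skew[OF x x] c M.r_neg by metis
qed

end

lemma two_torsion_free:
  assumes "module K M" "field K" and two: "[(2::nat)] \<cdot>\<^bsub>K\<^esub> \<one>\<^bsub>K\<^esub> \<noteq> \<zero>\<^bsub>K\<^esub>"
    and z: "z \<in> carrier M" "z \<oplus>\<^bsub>M\<^esub> z = \<zero>\<^bsub>M\<^esub>"
  shows "z = \<zero>\<^bsub>M\<^esub>"
proof -
  interpret M: module K M by fact
  interpret K: field K by fact
  let ?t = "\<one>\<^bsub>K\<^esub> \<oplus>\<^bsub>K\<^esub> \<one>\<^bsub>K\<^esub>"
  have "[(2::nat)] \<cdot>\<^bsub>K\<^esub> \<one>\<^bsub>K\<^esub> = ?t" by (simp add: numeral_2_eq_2)
  hence t: "?t \<in> Units K" using two K.field_Units by simp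
  have "?t \<odot>\<^bsub>M\<^esub> z = \<zero>\<^bsub>M\<^esub>" using z by (simp add: M.smult_l_distr)
  hence "inv\<^bsub>K\<^esub> ?t \<odot>\<^bsub>M\<^esub> (?t \<odot>\<^bsub>M\<^esub> z) = \<zero>\<^bsub>M\<^esub>" using t by simp
  moreover have "inv\<^bsub>K\<^esub> ?t \<odot>\<^bsub>M\<^esub> (?t \<odot>\<^bsub>M\<^esub> z) = z"
    using t z by (simp flip: M.smult_assoc1)
  ultimately show ?thesis by simp
qed

section \<open>The enveloping algebra of a Poisson-Ore extension\<close>

locale poisson_ore = poisson_superalgebra K R for K (structure) and R (structure) +
  fixes \<alpha> \<delta> :: "'b \<Rightarrow> 'b" and R' :: "('a, nat \<Rightarrow> 'b) poisson_superalg"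
  assumes ore: "poisson_ore_ext K R \<alpha> \<delta> R'"
begin

sublocale R': poisson_superalgebra K R'
  using ore by (simp add: poisson_ore_ext_def)

sublocale UP: UP_ring R "UP R"
  by (intro UP_ring.intro A.ring_axioms)

abbreviation "c \<equiv> const_poly R"
abbreviation "x \<equiv> var_poly R"

lemma poly_simps:
  "carrier R' = carrier (UP R)"
  "monoid.mult R' = monoid.mult (UP R)"
  "one R' = one (UP R)"
  "zero R' = zero (UP R)"
  "add R' = add (UP R)"
  "smult R' = (\<lambda>c p n. c \<odot>\<^bsub>R\<^esub> p n)"
  "grade R' = (\<lambda>d. {p \<in> carrier (UP R). \<forall>n. p n \<in> grade R d})"
  using ore by (simp_all add: poisson_ore_ext_def poly_superalg_def superalg.defs)

lemma grade_zero: "\<zero>\<^bsub>R\<^esub> \<in> grade R p"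
  using grade_submodule[of p] subgroup.one_closed submodule.axioms(1) by fastforce

lemma monom_coeff: "a \<in> carrier R \<Longrightarrow> monom (UP R) a n i = (if i = n then a else \<zero>\<^bsub>R\<^esub>)"
  by (simp add: UP_def)

lemma c_closed: "r \<in> carrier R \<Longrightarrow> c r \<in> carrier R'"
  by (simp add: poly_simps const_poly_def)

lemma c_hom: "c \<in> superalgebra_hom K R R'"
proof -
  have "monom (UP R) (k \<odot>\<^bsub>R\<^esub> r) 0 = (\<lambda>n. k \<odot>\<^bsub>R\<^esub> monom (UP R) r 0 n)"
    if "k \<in> carrier K" "r \<in> carrier R" for k r
    using that by (auto simp: monom_coeff)
  thus ?thesis
    unfolding superalgebra_hom_def algebra_hom_def ring_hom_def linear_maps_def even_maps_def const_poly_def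
    using grade_zero grade_closed
    by (auto simp: poly_simps UP.monom_mult[of _ _ 0 0, simplified] monom_coeff)
qed

lemma x_even: "x \<in> grade R' 0"
  by (simp add: poly_simps var_poly_def monom_coeff grade_one grade_zero)

lemma monom_times_x: "a \<in> carrier R \<Longrightarrow> monom (UP R) a (Suc n) = monom (UP R) a n \<otimes>\<^bsub>R'\<^esub> x"
  using UP.monom_mult[of a "\<one>\<^bsub>R\<^esub>" n 1] by (simp add: poly_simps var_poly_def)

lemma maps_closed:
  "r \<in> carrier R \<Longrightarrow> \<alpha> r \<in> carrier R" "r \<in> carrier R \<Longrightarrow> \<delta> r \<in> carrier R"
  using ore by (auto simp: poisson_ore_ext_def even_poisson_superderivation_def
      even_superderivation_def linear_maps_def)

lemma bracket_const:
  "\<lbrakk>r \<in> carrier R; s \<in> carrier R\<rbrakk> \<Longrightarrow> pbracket R' (c r) (c s) = c (pbracket R r s)"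
  using ore by (simp add: poisson_ore_ext_def)

lemma bracket_x_const:
  "r \<in> carrier R \<Longrightarrow> pbracket R' x (c r) = c (\<alpha> r) \<otimes>\<^bsub>R'\<^esub> x \<oplus>\<^bsub>R'\<^esub> c (\<delta> r)"
  using ore by (simp add: poisson_ore_ext_def)

abbreviation "U \<equiv> UEA K R"
abbreviation "U' \<equiv> UEA K R'"
abbreviation "m \<equiv> uea_m K R"
abbreviation "h \<equiv> uea_h K R"
abbreviation "m' \<equiv> uea_m K R'"
abbreviation "h' \<equiv> uea_h K R'"

sublocale U: assoc_algebra K U by (rule UEA_assoc_algebra)
sublocale U': assoc_algebra K U' by (rule R'.UEA_assoc_algebra)

lemma c_simps:
  "\<lbrakk>r \<in> carrier R; s \<in> carrier R\<rbrakk> \<Longrightarrow> c (r \<otimes>\<^bsub>R\<^esub> s) = c r \<otimes>\<^bsub>R'\<^esub> c s"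
  "\<lbrakk>r \<in> carrier R; s \<in> carrier R\<rbrakk> \<Longrightarrow> c (r \<oplus>\<^bsub>R\<^esub> s) = c r \<oplus>\<^bsub>R'\<^esub> c s"
  "c \<one>\<^bsub>R\<^esub> = \<one>\<^bsub>R'\<^esub>"
  "\<lbrakk>k \<in> carrier K; r \<in> carrier R\<rbrakk> \<Longrightarrow> c (k \<odot>\<^bsub>R\<^esub> r) = k \<odot>\<^bsub>R'\<^esub> c r"
  "r \<in> grade R p \<Longrightarrow> c r \<in> grade R' p"
  using c_hom by (auto simp: superalgebra_hom_def algebra_hom_def ring_hom_def linear_maps_def even_maps_def
      image_subset_iff)

lemma mh'_simps:
  "z \<in> carrier R' \<Longrightarrow> m' z \<in> carrier U'"
  "z \<in> carrier R' \<Longrightarrow> h' z \<in> carrier U'"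
  "\<lbrakk>z \<in> carrier R'; w \<in> carrier R'\<rbrakk> \<Longrightarrow> m' (z \<oplus>\<^bsub>R'\<^esub> w) = m' z \<oplus>\<^bsub>U'\<^esub> m' w"
  "\<lbrakk>z \<in> carrier R'; w \<in> carrier R'\<rbrakk> \<Longrightarrow> h' (z \<oplus>\<^bsub>R'\<^esub> w) = h' z \<oplus>\<^bsub>U'\<^esub> h' w"
  "\<lbrakk>z \<in> carrier R'; w \<in> carrier R'\<rbrakk> \<Longrightarrow> m' (z \<otimes>\<^bsub>R'\<^esub> w) = m' z \<otimes>\<^bsub>U'\<^esub> m' w"
  using R'.UEA_pre by (auto simp: pre_property_P_def algebra_hom_def linear_maps_def ring_hom_def)

text \<open>
  The inclusion \<open>R \<rightarrow> R'\<close> respects products, grading and brackets, so the generators of \<open>U(R')\<close>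
  indexed by constants satisfy property P for \<open>R\<close>.
\<close>

lemma ex_inclusion:
  "\<exists>i \<in> ring_hom U U'. \<forall>r\<in>carrier R. i (m r) = m' (c r) \<and> i (h r) = h' (c r)"
proof -
  have "property_P K R' U' m' h'" by (rule UEA_universal(1)[OF R'.poisson_superalgebra_axioms])
  hence "property_P K R U' (\<lambda>r. m' (c r)) (\<lambda>r. h' (c r))"
    using c_closed grade_closed
    by (auto simp: property_P_def superalgebra_hom_def algebra_hom_def ring_hom_def linear_maps_def
        even_maps_def c_simps image_subset_iff simp flip: bracket_const simp del: mult_bit_eq_and)
  from UEA_universal(2)[OF poisson_superalgebra_axioms this] show ?thesis
    by (auto simp: superalgebra_hom_def algebra_hom_def)
qed

lemma x_closed: "x \<in> carrier R'"
  using x_even R'.grade_closed by blast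

text \<open>
  The commutation rules of \<open>m\<^sub>x\<close> and \<open>h\<^sub>x\<close> with the generators of \<open>U(R)\<close>.  They have exactly
  the form \<open>y t = \<sigma>(t) y + \<eta>(t)\<close> with the prescribed values of \<open>\<sigma>\<^sub>1, \<eta>\<^sub>1, \<sigma>\<^sub>2, \<eta>\<^sub>2\<close>.  In the last
  one, \<open>h\<close> of the bracket \<open>{x,r} = \<alpha>(r) x + \<delta>(r)\<close> contains the summand \<open>m\<^sub>x h\<^bsub>\<alpha>(r)\<^esub>\<close>; moving
  \<open>m\<^sub>x\<close> to the right creates the terms with \<open>\<alpha>\<^sup>2(r)\<close> and \<open>\<delta>\<alpha>(r)\<close>.
\<close>

lemma x_relations:
  assumes r: "r \<in> carrier R"
  shows "m' x \<otimes>\<^bsub>U'\<^esub> m' (c r) = m' (c r) \<otimes>\<^bsub>U'\<^esub> m' x"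
    and "m' x \<otimes>\<^bsub>U'\<^esub> h' (c r)
      = (h' (c r) \<oplus>\<^bsub>U'\<^esub> m' (c (\<alpha> r))) \<otimes>\<^bsub>U'\<^esub> m' x \<oplus>\<^bsub>U'\<^esub> m' (c (\<delta> r))"
    and "h' x \<otimes>\<^bsub>U'\<^esub> m' (c r)
      = m' (c r) \<otimes>\<^bsub>U'\<^esub> h' x \<oplus>\<^bsub>U'\<^esub> (m' (c (\<alpha> r)) \<otimes>\<^bsub>U'\<^esub> m' x \<oplus>\<^bsub>U'\<^esub> m' (c (\<delta> r)))"
    and "h' x \<otimes>\<^bsub>U'\<^esub> h' (c r)
      = (h' (c r) \<oplus>\<^bsub>U'\<^esub> m' (c (\<alpha> r))) \<otimes>\<^bsub>U'\<^esub> h' x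
        \<oplus>\<^bsub>U'\<^esub> ((h' (c (\<alpha> r)) \<oplus>\<^bsub>U'\<^esub> m' (c (\<alpha> (\<alpha> r)))) \<otimes>\<^bsub>U'\<^esub> m' x
          \<oplus>\<^bsub>U'\<^esub> (m' (c (\<delta> (\<alpha> r))) \<oplus>\<^bsub>U'\<^esub> h' (c (\<delta> r))))"
proof -
  note rel = R'.property_P_even[OF R'.UEA_pre x_even c_closed]
  note simps = bracket_x_const r maps_closed c_closed x_closed mh'_simps U'.A.l_distr U'.M.a_ac U'.A.m_assoc
  show "m' x \<otimes>\<^bsub>U'\<^esub> m' (c r) = m' (c r) \<otimes>\<^bsub>U'\<^esub> m' x"
    by (rule rel(5)[OF r])
  have mh: "m' x \<otimes>\<^bsub>U'\<^esub> h' (c r)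
      = (h' (c r) \<oplus>\<^bsub>U'\<^esub> m' (c (\<alpha> r))) \<otimes>\<^bsub>U'\<^esub> m' x \<oplus>\<^bsub>U'\<^esub> m' (c (\<delta> r))"
    if "r \<in> carrier R" for r
    using rel(3)[OF that] that by (simp add: simps)
  thus "m' x \<otimes>\<^bsub>U'\<^esub> h' (c r)
      = (h' (c r) \<oplus>\<^bsub>U'\<^esub> m' (c (\<alpha> r))) \<otimes>\<^bsub>U'\<^esub> m' x \<oplus>\<^bsub>U'\<^esub> m' (c (\<delta> r))"
    using r .
  show "h' x \<otimes>\<^bsub>U'\<^esub> m' (c r)
      = m' (c r) \<otimes>\<^bsub>U'\<^esub> h' x \<oplus>\<^bsub>U'\<^esub> (m' (c (\<alpha> r)) \<otimes>\<^bsub>U'\<^esub> m' x \<oplus>\<^bsub>U'\<^esub> m' (c (\<delta> r)))"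
    using rel(2)[OF r] by (simp add: simps)
  show "h' x \<otimes>\<^bsub>U'\<^esub> h' (c r)
      = (h' (c r) \<oplus>\<^bsub>U'\<^esub> m' (c (\<alpha> r))) \<otimes>\<^bsub>U'\<^esub> h' x
        \<oplus>\<^bsub>U'\<^esub> ((h' (c (\<alpha> r)) \<oplus>\<^bsub>U'\<^esub> m' (c (\<alpha> (\<alpha> r)))) \<otimes>\<^bsub>U'\<^esub> m' x
          \<oplus>\<^bsub>U'\<^esub> (m' (c (\<delta> (\<alpha> r))) \<oplus>\<^bsub>U'\<^esub> h' (c (\<delta> r))))"
    using rel(1)[OF r] rel(4)[OF maps_closed(1)[OF r]] mh[OF maps_closed(1)[OF r]]
    by (simp add: simps)
qed

text \<open>
  The commutator is \<open>m({x,x})\<close>, and skew-symmetry gives only \<open>2{x,x} = 0\<close> for even \<open>x\<close>;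
  hence the condition on \<open>2\<close>-torsion.
\<close>

lemma mh'_commute_x:
  assumes "\<And>z. \<lbrakk>z \<in> carrier R'; z \<oplus>\<^bsub>R'\<^esub> z = \<zero>\<^bsub>R'\<^esub>\<rbrakk> \<Longrightarrow> z = \<zero>\<^bsub>R'\<^esub>"
  shows "h' x \<otimes>\<^bsub>U'\<^esub> m' x = m' x \<otimes>\<^bsub>U'\<^esub> h' x"
proof -
  have "m' \<zero>\<^bsub>R'\<^esub> = \<zero>\<^bsub>U'\<^esub>"
    using ring_hom_zero[of m' R' U'] R'.UEA_pre R'.A.ring_axioms U'.A.ring_axioms
    by (simp add: pre_property_P_def algebra_hom_def)
  thus ?thesis
    using R'.property_P_even(2)[OF R'.UEA_pre x_even x_closed]
      R'.even_bracket_self[OF x_even assms] x_closed mh'_simps by simp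
qed

text \<open>
  By definition \<open>U(R')\<close> has generators \<open>m\<^sub>z, h\<^sub>z\<close> for all polynomials \<open>z\<close>.  Those for
  \<open>z \<in> R\<close> and \<open>z = x\<close> suffice, since \<open>m\<^bsub>zx\<^esub> = m\<^sub>z m\<^sub>x\<close> and
  \<open>h\<^bsub>zx\<^esub> = m\<^sub>z h\<^sub>x + m\<^sub>x h\<^sub>z\<close> raise the degree of a monomial by one.
\<close>

lemma generator_induct:
  assumes z: "z \<in> carrier R'"
    and const: "\<And>r. r \<in> carrier R \<Longrightarrow> Q (m' (c r)) \<and> Q (h' (c r))"
    and var: "Q (m' x)" "Q (h' x)"
    and add: "\<And>u v. \<lbrakk>u \<in> carrier U'; v \<in> carrier U'; Q u; Q v\<rbrakk> \<Longrightarrow> Q (u \<oplus>\<^bsub>U'\<^esub> v)"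
    and mult: "\<And>u v. \<lbrakk>u \<in> carrier U'; v \<in> carrier U'; Q u; Q v\<rbrakk> \<Longrightarrow> Q (u \<otimes>\<^bsub>U'\<^esub> v)"
  shows "Q (m' z) \<and> Q (h' z)"
proof -
  have "z \<in> carrier (UP R)" using z by (simp add: poly_simps)
  thus ?thesis
  proof (induction rule: UP.poly_monom_induct)
    case (monom a n)
    show ?case
    proof (induction n)
      case 0
      show ?case using const[OF monom] by (simp add: const_poly_def)
    next
      case (Suc n)
      have mon: "monom (UP R) a n \<in> carrier R'" using monom by (simp add: poly_simps)
      show ?case
        using Suc mon x_closed monom R'.property_P_even(4)[OF R'.UEA_pre x_even mon]
        by (simp add: monom_times_x mh'_simps add mult var)
    qed
  next
    case (add p q)
    hence "p \<in> carrier R'" "q \<in> carrier R'" "p \<oplus>\<^bsub>UP R\<^esub> q = p \<oplus>\<^bsub>R'\<^esub> q" by (simp_all add: poly_simps)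
    thus ?case using add assms(5) by (simp add: mh'_simps)
  qed
qed

end

section \<open>The isomorphism\<close>

theorem theorem7p8:
  fixes K :: "'k ring"
    and R :: "('k, 'a) poisson_superalg"
    and R' :: "('k, nat \<Rightarrow> 'a) poisson_superalg"
    and \<alpha> \<delta> :: "'a \<Rightarrow> 'a"
    and \<sigma>1 \<eta>1 :: "('k, 'a) uea_term set \<Rightarrow> ('k, 'a) uea_term set"
    and \<sigma>2 \<eta>2 :: "(nat \<Rightarrow> ('k, 'a) uea_term set) \<Rightarrow> (nat \<Rightarrow> ('k, 'a) uea_term set)"
    and U :: "('k, ('k, 'a) uea_term set) superalg"
    and m h :: "'a \<Rightarrow> ('k, 'a) uea_term set"
    and U' :: "('k, ('k, nat \<Rightarrow> 'a) uea_term set) superalg"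
    and m' h' :: "(nat \<Rightarrow> 'a) \<Rightarrow> ('k, nat \<Rightarrow> 'a) uea_term set"
    and T1 :: "('k, nat \<Rightarrow> ('k, 'a) uea_term set) superalg"
    and T2 :: "('k, nat \<Rightarrow> nat \<Rightarrow> ('k, 'a) uea_term set) superalg"
    and \<phi> :: "('k, nat \<Rightarrow> 'a) uea_term set \<Rightarrow> (nat \<Rightarrow> nat \<Rightarrow> ('k, 'a) uea_term set)"
  assumes K_field: "field K"
    and K_char_0: "\<And>n::nat. n > 0 \<Longrightarrow> [n] \<cdot>\<^bsub>K\<^esub> \<one>\<^bsub>K\<^esub> \<noteq> \<zero>\<^bsub>K\<^esub>"
    and R: "poisson_superalgebra K R"
    and R': "poisson_ore_ext K R \<alpha> \<delta> R'"
    and U: "U = UEA K R" "m = uea_m K R" "h = uea_h K R"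
    and U': "U' = UEA K R'" "m' = uea_m K R'" "h' = uea_h K R'"
    and \<sigma>1: "\<sigma>1 \<in> algebra_auto K U"
      "\<And>r. r \<in> carrier R \<Longrightarrow> \<sigma>1 (m r) = m r"
      "\<And>r. r \<in> carrier R \<Longrightarrow> \<sigma>1 (h r) = h r \<oplus>\<^bsub>U\<^esub> m (\<alpha> r)"
    and \<eta>1: "sigma_derivation U \<sigma>1 \<eta>1"
      "\<And>r. r \<in> carrier R \<Longrightarrow> \<eta>1 (m r) = \<zero>\<^bsub>U\<^esub>"
      "\<And>r. r \<in> carrier R \<Longrightarrow> \<eta>1 (h r) = m (\<delta> r)"
    and T1: "T1 = ore_ext U \<sigma>1 \<eta>1"
    and \<sigma>2: "\<sigma>2 \<in> algebra_auto K T1"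
      "\<And>r. r \<in> carrier R \<Longrightarrow> \<sigma>2 (const_poly U (m r)) = const_poly U (m r)"
      "\<And>r. r \<in> carrier R \<Longrightarrow> \<sigma>2 (const_poly U (h r)) = const_poly U (h r \<oplus>\<^bsub>U\<^esub> m (\<alpha> r))"
      "\<sigma>2 (var_poly U) = var_poly U"
    and \<eta>2: "sigma_derivation T1 \<sigma>2 \<eta>2"
      "\<And>r. r \<in> carrier R \<Longrightarrow> \<eta>2 (const_poly U (m r))
         = const_poly U (m (\<alpha> r)) \<otimes>\<^bsub>T1\<^esub> var_poly U \<oplus>\<^bsub>T1\<^esub> const_poly U (m (\<delta> r))"
      "\<And>r. r \<in> carrier R \<Longrightarrow> \<eta>2 (const_poly U (h r))
         = const_poly U (h (\<alpha> r) \<oplus>\<^bsub>U\<^esub> m (\<alpha> (\<alpha> r))) \<otimes>\<^bsub>T1\<^esub> var_poly U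
           \<oplus>\<^bsub>T1\<^esub> const_poly U (m (\<delta> (\<alpha> r)) \<oplus>\<^bsub>U\<^esub> h (\<delta> r))"
      "\<eta>2 (var_poly U) = \<zero>\<^bsub>T1\<^esub>"
    and T2: "T2 = ore_ext T1 \<sigma>2 \<eta>2"
    and \<phi>: "\<phi> \<in> superalgebra_hom K U' T2"
      "\<And>r. r \<in> carrier R \<Longrightarrow> \<phi> (m' (const_poly R r)) = const_poly T1 (const_poly U (m r))"
      "\<And>r. r \<in> carrier R \<Longrightarrow> \<phi> (h' (const_poly R r)) = const_poly T1 (const_poly U (h r))"
      "\<phi> (m' (var_poly R)) = const_poly T1 (var_poly U)"
      "\<phi> (h' (var_poly R)) = var_poly T1"
  shows "\<phi> \<in> superalgebra_iso K U' T2"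
proof -
  interpret P: poisson_ore K R \<alpha> \<delta> R'
    using R R' by (intro poisson_ore.intro poisson_ore_axioms.intro)
  interpret U: ring U unfolding U by (rule P.U.A.ring_axioms)
  interpret U': ring U' unfolding U' by (rule P.U'.A.ring_axioms)
  have D1: "ore_data U \<sigma>1 \<eta>1"
    using \<sigma>1(1) \<eta>1(1) U.ring_axioms
    by (intro ore_data.intro ore_data_axioms.intro) (auto simp: algebra_auto_def algebra_hom_def)
  interpret E1: ore_data U \<sigma>1 \<eta>1 by (rule D1)
  interpret T1: ring T1 unfolding T1 by (rule E1.ring_S)
  interpret E2: ore_data T1 \<sigma>2 \<eta>2
    using \<sigma>2(1) \<eta>2(1) T1.ring_axioms
    by (intro ore_data.intro ore_data_axioms.intro) (auto simp: algebra_auto_def algebra_hom_def)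
  interpret T2: ring T2 unfolding T2 by (rule E2.ring_S)
  note U_induct [consumes 1, case_names m h add mult] = P.UEA_induct[folded U]
    and T1_induct [consumes 1, case_names m h var add mult] = P.ore_ext_UEA_induct[folded U, OF D1, folded T1]
    and T2_induct [consumes 1, case_names const var add mult] = E2.ore_ext_induct[folded T2]
    and U'_induct [consumes 1, case_names m h add mult] = P.R'.UEA_induct[folded U']
    and rel = P.x_relations[folded U']
  have mh: "m r \<in> carrier U" "h r \<in> carrier U" if "r \<in> carrier R" for r
    using that P.UEA_pre
    by (auto simp: U pre_property_P_def algebra_hom_def linear_maps_def)
  note mh' = P.mh'_simps(1,2)[folded U'] and xc = P.x_closed and R_maps = P.maps_closed

  \<comment> \<open>The inverse is built in three stages: on \<open>U(R)\<close>, on \<open>T1\<close> and on \<open>T2\<close>.\<close>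
  obtain i where i: "i \<in> ring_hom U U'"
    and i_gen: "\<And>r. r \<in> carrier R \<Longrightarrow> i (m r) = m' (const_poly R r)"
      "\<And>r. r \<in> carrier R \<Longrightarrow> i (h r) = h' (const_poly R r)"
    using P.ex_inclusion unfolding U U' by blast
  note i_simps = i_gen mh R_maps ring_hom_add[OF i] ring_hom_mult[OF i]
    ring_hom_zero[OF i U.ring_axioms U'.ring_axioms]

  have skew1: "m' (var_poly R) \<otimes>\<^bsub>U'\<^esub> i t
      = i (\<sigma>1 t) \<otimes>\<^bsub>U'\<^esub> m' (var_poly R) \<oplus>\<^bsub>U'\<^esub> i (\<eta>1 t)"
    if "t \<in> carrier U" for t
    using that
  proof (induction rule: U_induct)
    case (m r)
    thus ?case using mh' xc P.c_closed by (simp add: \<sigma>1 \<eta>1 i_simps rel(1))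
  next
    case (h r)
    thus ?case by (simp add: \<sigma>1 \<eta>1 i_simps rel(2))
  next
    case (add u v)
    thus ?case
      by (intro skew_relation_closed(1)[OF U.ring_axioms U'.ring_axioms i E1.sigma E1.eta mh'(1)[OF xc]])
  next
    case (mult u v)
    thus ?case
      by (intro skew_relation_closed(2)[OF U.ring_axioms U'.ring_axioms i E1.sigma E1.eta mh'(1)[OF xc]])
  qed
  interpret F1: ore_target U \<sigma>1 \<eta>1 U' i "m' (var_poly R)"
    by (intro ore_target.intro ore_target_axioms.intro E1.ore_data_axioms U'.ring_axioms i mh' xc skew1)
  define \<psi>1 where "\<psi>1 = F1.ore_eval"
  have \<psi>1: "\<psi>1 \<in> ring_hom T1 U'"
    and \<psi>1_const: "\<And>u. u \<in> carrier U \<Longrightarrow> \<psi>1 (const_poly U u) = i u"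
    and \<psi>1_var: "\<psi>1 (var_poly U) = m' (var_poly R)"
    unfolding \<psi>1_def using F1.ore_eval_hom F1.ore_eval_const F1.ore_eval_var by (simp_all add: T1)
  note c1 = E1.const_var_closed[folded T1]
  note \<psi>1_simps = \<psi>1_const \<psi>1_var ring_hom_add[OF \<psi>1] ring_hom_mult[OF \<psi>1]
    ring_hom_zero[OF \<psi>1 T1.ring_axioms U'.ring_axioms] c1 i_simps

  have skew2: "h' (var_poly R) \<otimes>\<^bsub>U'\<^esub> \<psi>1 t
      = \<psi>1 (\<sigma>2 t) \<otimes>\<^bsub>U'\<^esub> h' (var_poly R) \<oplus>\<^bsub>U'\<^esub> \<psi>1 (\<eta>2 t)"
    if "t \<in> carrier T1" for t
    using that
  proof (induction rule: T1_induct)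
    case (m r)
    thus ?case by (simp add: \<sigma>2 \<eta>2 \<psi>1_simps rel(3))
  next
    case (h r)
    thus ?case by (simp add: \<sigma>2 \<eta>2 \<psi>1_simps rel(4))
  next
    case var
    have half: "z = \<zero>\<^bsub>R'\<^esub>" if "z \<in> carrier R'" "z \<oplus>\<^bsub>R'\<^esub> z = \<zero>\<^bsub>R'\<^esub>" for z
      by (rule two_torsion_free[OF P.R'.module_axioms K_field K_char_0 that]) simp
    have "h' (var_poly R) \<otimes>\<^bsub>U'\<^esub> m' (var_poly R) = m' (var_poly R) \<otimes>\<^bsub>U'\<^esub> h' (var_poly R)"
      using P.mh'_commute_x[OF half] by (simp add: U')
    thus ?case using mh'[OF xc] by (simp add: \<sigma>2 \<eta>2 \<psi>1_simps)
  next
    case (add p q)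
    thus ?case
      by (intro skew_relation_closed(1)[OF T1.ring_axioms U'.ring_axioms \<psi>1 E2.sigma E2.eta mh'(2)[OF xc]])
  next
    case (mult p q)
    thus ?case
      by (intro skew_relation_closed(2)[OF T1.ring_axioms U'.ring_axioms \<psi>1 E2.sigma E2.eta mh'(2)[OF xc]])
  qed
  interpret F2: ore_target T1 \<sigma>2 \<eta>2 U' \<psi>1 "h' (var_poly R)"
    by (intro ore_target.intro ore_target_axioms.intro E2.ore_data_axioms U'.ring_axioms \<psi>1 mh' xc skew2)
  define \<psi> where "\<psi> = F2.ore_eval"
  have \<psi>: "\<psi> \<in> ring_hom T2 U'"
    and \<psi>_const: "\<And>t. t \<in> carrier T1 \<Longrightarrow> \<psi> (const_poly T1 t) = \<psi>1 t"
    and \<psi>_var: "\<psi> (var_poly T1) = h' (var_poly R)"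
    unfolding \<psi>_def using F2.ore_eval_hom F2.ore_eval_const F2.ore_eval_var by (simp_all add: T2)

  have \<phi>_hom: "\<phi> \<in> ring_hom U' T2"
    using \<phi>(1) by (simp add: superalgebra_hom_def algebra_hom_def)
  note \<phi>_simps = ring_hom_closed[OF \<phi>_hom] ring_hom_add[OF \<phi>_hom] ring_hom_mult[OF \<phi>_hom]
    ring_hom_add[OF \<psi>] ring_hom_mult[OF \<psi>]
  \<comment> \<open>On \<open>m\<^sub>r, h\<^sub>r, m\<^sub>x, h\<^sub>x\<close>, \<open>\<psi>\<close> reverses the prescribed values of \<open>\<phi>\<close>; the other generators follow.\<close>
  have gen: "\<psi> (\<phi> (m' z)) = m' z \<and> \<psi> (\<phi> (h' z)) = h' z" if "z \<in> carrier R'" for z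
    using P.generator_induct[OF that, of "\<lambda>u. \<psi> (\<phi> u) = u", folded U']
    by (simp add: \<phi> \<psi>_const \<psi>_var \<psi>1_simps \<phi>_simps)
  have inverse: "\<psi> (\<phi> u) = u" if "u \<in> carrier U'" for u
    using that by (induction rule: U'_induct) (simp_all add: gen[unfolded U'] gen \<phi>_simps)
  have inj: "inj_on \<phi> (carrier U')" by (rule inj_on_inverseI) (rule inverse)

  \<comment> \<open>The image of \<open>\<phi>\<close> is a subring of \<open>T2\<close> that contains generators.\<close>
  let ?I = "\<phi> ` carrier U'"
  have I_add: "p \<oplus>\<^bsub>T2\<^esub> q \<in> ?I" and I_mult: "p \<otimes>\<^bsub>T2\<^esub> q \<in> ?I" if "p \<in> ?I" "q \<in> ?I" for p q
    using that by (auto simp flip: \<phi>_simps(2,3))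
  have I_gen: "const_poly T1 (const_poly U (m r)) \<in> ?I" "const_poly T1 (const_poly U (h r)) \<in> ?I"
    if "r \<in> carrier R" for r
    using that by (auto simp: P.c_closed mh' simp flip: \<phi>(2,3))
  have I_var: "const_poly T1 (var_poly U) \<in> ?I" "var_poly T1 \<in> ?I"
    by (auto simp: xc mh' simp flip: \<phi>(4,5))
  note c2 = ring_hom_add[OF E2.const_poly_hom, folded T2] ring_hom_mult[OF E2.const_poly_hom, folded T2]
  have I_const: "const_poly T1 t \<in> ?I" if "t \<in> carrier T1" for t
    using that by (induction rule: T1_induct) (simp_all only: I_gen I_var I_add I_mult c2)
  have "p \<in> ?I" if "p \<in> carrier T2" for p
    using that by (induction rule: T2_induct) (simp_all only: I_const I_var I_add I_mult)
  hence "?I = carrier T2" using ring_hom_closed[OF \<phi>_hom] by blast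
  with inj \<phi>(1) show ?thesis by (simp add: superalgebra_iso_def bij_betw_def)
qed

end
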